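(* There exist infinitely many Diophantine triples over $\mathbb{Q}(i)$ whose induced elliptic curves have torsion group $E(\mathbb{Q}(i))_{\mathrm{tors}}\cong\mathbb{Z}/4\mathbb{Z}\times\mathbb{Z}/4\mathbb{Z}$. Moreover, there exists a Diophantine triple over the rational function field $\mathbb{Q}(i)(t)$ whose induced elliptic curve $E$ has torsion group $E(\mathbb{Q}(i)(t))_{\mathrm{tors}}\cong\mathbb{Z}/4\mathbb{Z}\times\mathbb{Z}/4\mathbb{Z}$ and positive rank over $\mathbb{Q}(i)(t)$.
   Context: For a field $\mathbb{K}$, a Diophantine triple over $\mathbb{K}$ is a set $\{a,b,c\}$ of three distinct nonzero elements of $\mathbb{K}$ such that $ab+1$, $ac+1$ and $bc+1$ are all squares in $\mathbb{K}$. The elliptic curve induced by the Diophantine triple $\{a,b,c\}$ is $E:\ y^2=(ax+1)(bx+1)(cx+1)$ over $\mathbb{K}$. Here $i=\sqrt{-1}$ and $t$ is transcendental over $\mathbb{Q}(i)$. *)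

theory Defs
  imports Complex_Main "HOL-Algebra.Elementary_Groups"
    "HOL-Computational_Algebra.Polynomial" "HOL-Computational_Algebra.Fraction_Field"
begin

definition gauss_rats :: "complex set"
  where "gauss_rats = {of_real (of_rat r) + of_real (of_rat s) * \<i> | r s. True}"

definition gauss_rat_poly :: "complex poly \<Rightarrow> bool"
  where "gauss_rat_poly p \<longleftrightarrow> (\<forall>n. coeff p n \<in> gauss_rats)"

text \<open>The rational function field Q(i)(t), realised inside the fraction field of C[t]
  (t = the polynomial variable, transcendental over Q(i)).\<close>
definition gauss_rat_funs :: "complex poly fract set"
  where "gauss_rat_funs =
     {Fract p q | p q. gauss_rat_poly p \<and> gauss_rat_poly q \<and> q \<noteq> 0}"

definition is_square_in :: "'a::field set \<Rightarrow> 'a \<Rightarrow> bool"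
  where "is_square_in K x \<longleftrightarrow> (\<exists>r\<in>K. x = r ^ 2)"

definition diophantine_triple :: "'a::field set \<Rightarrow> 'a \<Rightarrow> 'a \<Rightarrow> 'a \<Rightarrow> bool"
  where "diophantine_triple K a b c \<longleftrightarrow>
     a \<in> K \<and> b \<in> K \<and> c \<in> K \<and> a \<noteq> 0 \<and> b \<noteq> 0 \<and> c \<noteq> 0 \<and>
     a \<noteq> b \<and> a \<noteq> c \<and> b \<noteq> c \<and>
     is_square_in K (a*b + 1) \<and> is_square_in K (a*c + 1) \<and> is_square_in K (b*c + 1)"

datatype 'a ecpt = Infty | Pt 'a 'a

text \<open>Write the cubic as A x^3 + B x^2 + C x + 1.\<close>
definition cubA :: "'a::field \<Rightarrow> 'a \<Rightarrow> 'a \<Rightarrow> 'a" where "cubA a b c = a*b*c"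
definition cubB :: "'a::field \<Rightarrow> 'a \<Rightarrow> 'a \<Rightarrow> 'a" where "cubB a b c = a*b + a*c + b*c"
definition cubC :: "'a::field \<Rightarrow> 'a \<Rightarrow> 'a \<Rightarrow> 'a" where "cubC a b c = a + b + c"

definition on_curve :: "'a::field \<Rightarrow> 'a \<Rightarrow> 'a \<Rightarrow> 'a ecpt \<Rightarrow> bool"
  where "on_curve a b c P = (case P of Infty \<Rightarrow> True
      | Pt x y \<Rightarrow> y^2 = (a*x+1)*(b*x+1)*(c*x+1))"

definition ec_points :: "'a::field set \<Rightarrow> 'a \<Rightarrow> 'a \<Rightarrow> 'a \<Rightarrow> 'a ecpt set"
  where "ec_points K a b c = {P. on_curve a b c P \<and>
      (case P of Infty \<Rightarrow> True | Pt x y \<Rightarrow> x \<in> K \<and> y \<in> K)}"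

definition ec_add :: "'a::field \<Rightarrow> 'a \<Rightarrow> 'a \<Rightarrow> 'a ecpt \<Rightarrow> 'a ecpt \<Rightarrow> 'a ecpt"
  where "ec_add a b c P Q = (case P of Infty \<Rightarrow> Q | Pt x1 y1 \<Rightarrow>
     (case Q of Infty \<Rightarrow> P | Pt x2 y2 \<Rightarrow>
       (if x1 = x2 \<and> y1 = - y2 then Infty
        else let l = (if x1 = x2
                      then (3 * cubA a b c * x1^2 + 2 * cubB a b c * x1 + cubC a b c) / (2 * y1)
                      else (y2 - y1) / (x2 - x1));
                 x3 = (l^2 - cubB a b c) / cubA a b c - x1 - x2
             in Pt x3 (- (y1 + l * (x3 - x1))))))"

fun ec_mult :: "'a::field \<Rightarrow> 'a \<Rightarrow> 'a \<Rightarrow> nat \<Rightarrow> 'a ecpt \<Rightarrow> 'a ecpt" where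
  "ec_mult a b c 0 P = Infty"
| "ec_mult a b c (Suc n) P = ec_add a b c P (ec_mult a b c n P)"

definition ec_torsion :: "'a::field set \<Rightarrow> 'a \<Rightarrow> 'a \<Rightarrow> 'a \<Rightarrow> 'a ecpt set"
  where "ec_torsion K a b c =
     {P \<in> ec_points K a b c. \<exists>n::nat. n \<ge> 1 \<and> ec_mult a b c n P = Infty}"

definition ec_group :: "'a::field set \<Rightarrow> 'a \<Rightarrow> 'a \<Rightarrow> 'a \<Rightarrow> 'a ecpt monoid"
  where "ec_group K a b c = \<lparr>carrier = ec_points K a b c, monoid.mult = ec_add a b c, one = Infty\<rparr>"

definition ec_torsion_group :: "'a::field set \<Rightarrow> 'a \<Rightarrow> 'a \<Rightarrow> 'a \<Rightarrow> 'a ecpt monoid"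
  where "ec_torsion_group K a b c = \<lparr>carrier = ec_torsion K a b c, monoid.mult = ec_add a b c, one = Infty\<rparr>"

definition ec_positive_rank :: "'a::field set \<Rightarrow> 'a \<Rightarrow> 'a \<Rightarrow> 'a \<Rightarrow> bool"
  where "ec_positive_rank K a b c \<longleftrightarrow> ec_points K a b c - ec_torsion K a b c \<noteq> {}"

definition Z4xZ4 :: "(int \<times> int) monoid"
  where "Z4xZ4 = DirProd (integer_mod_group 4) (integer_mod_group 4)"

end

theory Submission
  imports Defs
begin

text \<open>
  Parametrise the conic $q^2 = u^2 - up + p^2$ by $u = 1 + 2t$, $p = 1 - t^2$, $q = 1 + t + t^2$.
  The triple $a = -4ipqu / ((u+p)(u^2+p^2))$, $b = -i(u^2+p^2) / ((u+p)q)$, $c = -1/b$ satisfies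
  $bc + 1 = 0$, while $ab + 1 = b(a-c)$, $ac + 1 = c(a-b)$ and $a(b-c)$ are squares; hence all
  2-torsion points of the induced curve are divisible by 2.

  If $t$ is congruent to $i$ modulo 9, the curve reduces modulo 3 to $y^2 = x^3 + x + 1$ over the
  field with nine elements, whose group of points is killed by 4. As the kernel of reduction is
  torsion-free, all torsion is killed by 4, so it is $Z/4 \<times> Z/4$. The point $(0,1)$ is not
  killed by 4, so it has infinite order.

  For $Q(i)$ take $t = i + 9n$. For $Q(i)(T)$ take $t = i + T$ and the valuation ring of functions
  whose value at $T = 0$ is integral at 3.
\<close>

section \<open>The group law\<close>

text \<open>The prime 3 is inert in Q(i), and y^2 = x^3 + x + 1 has four points over the field with
  three elements, hence trace zero: the squared Frobenius acts as -3, and since it fixes the points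
  over the field with nine elements, 4 kills them. One prime of good reduction thus gives the sharp
  bound, without any classification of torsion over Q(i). The same prime makes (0,1) delicate: its
  reduction has order 4, and the residues -1, 1 - i, 1 + i of the triple satisfy a = b + c, one of
  the conditions under which 4(0,1) = 0. A congruence modulo 9 is what separates (0,1) from the
  torsion.

  For the function field, the place T = 0 followed by reduction at 3 has a valuation ring of rank
  two, in which T is divisible by every power of 3. So no integer-valued valuation is used: sizes
  are compared by divisibility in an axiomatically given ring, and the descent on torsion never asks
  the powers of 3 to have trivial intersection. One argument then serves both fields.\<close>

locale triple_curve =
  fixes a b c :: "'a::field_char_0"
  assumes a_nz: "a \<noteq> 0" and b_nz: "b \<noteq> 0" and c_nz: "c \<noteq> 0"
    and a_neq_b: "a \<noteq> b" and a_neq_c: "a \<noteq> c" and b_neq_c: "b \<noteq> c"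
begin

abbreviation A where "A \<equiv> cubA a b c"
abbreviation B where "B \<equiv> cubB a b c"
abbreviation C where "C \<equiv> cubC a b c"
abbreviation curve where "curve \<equiv> on_curve a b c"
abbreviation add where "add \<equiv> ec_add a b c"

fun neg :: "'a ecpt \<Rightarrow> 'a ecpt" where
  "neg Infty = Infty"
| "neg (Pt x y) = Pt x (- y)"

text \<open>The two equations determine the slope of the chord or tangent uniformly: the first
  one does so if the abscissae differ, the second one if the ordinates are not opposite.\<close>
definition slope :: "'a \<Rightarrow> 'a \<Rightarrow> 'a \<Rightarrow> 'a \<Rightarrow> 'a \<Rightarrow> bool" where
  "slope x1 y1 x2 y2 l \<longleftrightarrow> y1 - y2 = l * (x1 - x2) \<and>
     l * (y1 + y2) = A * (x1^2 + x1*x2 + x2^2) + B * (x1 + x2) + C"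

lemma A_nz: "A \<noteq> 0"
  using a_nz b_nz c_nz by (simp add: cubA_def)

lemma curve_Infty [simp]: "curve Infty"
  by (simp add: on_curve_def)

lemma curve_Pt: "curve (Pt x y) \<longleftrightarrow> y^2 = A*x^3 + B*x^2 + C*x + 1"
  by (simp add: on_curve_def cubA_def cubB_def cubC_def algebra_simps power2_eq_square power3_eq_cube)

text \<open>The factors vanish at -1/a, -1/b, -1/c, which are pairwise distinct; a common zero of
  the cubic and its derivative would kill two factors at once.\<close>

lemma smooth:
  assumes "A*x^3 + B*x^2 + C*x + 1 = 0" and "3*A*x^2 + 2*B*x + C = 0"
  shows False
proof -
  have 1: "(a*x+1)*(b*x+1)*(c*x+1) = 0"
    using assms(1)
    by (simp add: cubA_def cubB_def cubC_def algebra_simps power2_eq_square power3_eq_cube)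
  have 2: "a*(b*x+1)*(c*x+1) + b*(a*x+1)*(c*x+1) + c*(a*x+1)*(b*x+1) = 0"
    using assms(2)
    by (simp add: cubA_def cubB_def cubC_def algebra_simps power2_eq_square power3_eq_cube)
  have dist: "u = v" if "u*x + 1 = 0" "v*x + 1 = 0" for u v
  proof -
    have "x \<noteq> 0" using that by auto
    moreover have "(u - v)*x = 0" using that by algebra
    ultimately show ?thesis by simp
  qed
  show False
    using 1 2 dist a_nz b_nz c_nz a_neq_b a_neq_c b_neq_c by auto
qed

lemma slope_commute: "slope x1 y1 x2 y2 l \<Longrightarrow> slope x2 y2 x1 y1 l"
  unfolding slope_def by (auto simp: algebra_simps)

lemma slope_unique:
  assumes "slope x1 y1 x2 y2 l" "slope x1 y1 x2 y2 m" "\<not> (x1 = x2 \<and> y1 = - y2)"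
  shows "l = m"
proof (cases "x1 = x2")
  case True
  then have "y1 + y2 \<noteq> 0" using assms(3) by (auto simp: add_eq_0_iff)
  moreover have "l * (y1 + y2) = m * (y1 + y2)"
    using assms(1,2) unfolding slope_def by metis
  ultimately show ?thesis by simp
next
  case False
  moreover have "l * (x1 - x2) = m * (x1 - x2)"
    using assms(1,2) unfolding slope_def by metis
  ultimately show ?thesis by simp
qed

lemma curve_same_x:
  assumes "curve (Pt x y1)" "curve (Pt x y2)" "y1 \<noteq> - y2"
  shows "y1 = y2"
  using assms unfolding curve_Pt by (metis power2_eq_iff)

text \<open>For a chord, subtracting the two curve equations and dividing by \<open>x1 - x2\<close>
  gives the second slope equation; for a tangent that equation is the definition of the slope. With
  both in hand, chord and tangent are later treated by the same polynomial computation.\<close>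

lemma slope_exists:
  assumes P: "curve (Pt x1 y1)" and Q: "curve (Pt x2 y2)" and ne: "\<not> (x1 = x2 \<and> y1 = - y2)"
  obtains l where "slope x1 y1 x2 y2 l"
    and "add (Pt x1 y1) (Pt x2 y2) =
      Pt ((l^2 - B) / A - x1 - x2) (- (y1 + l * ((l^2 - B) / A - x1 - x2 - x1)))"
proof (cases "x1 = x2")
  case True
  with ne have "y1 \<noteq> - y2" by simp
  then have y: "y2 = y1" using curve_same_x P Q True by metis
  then have y0: "y1 \<noteq> 0" using \<open>y1 \<noteq> - y2\<close> by auto
  define l where "l = (3 * A * x1^2 + 2 * B * x1 + C) / (2 * y1)"
  have "slope x1 y1 x2 y2 l"
    using y0 y True unfolding slope_def l_def by (simp add: field_simps power2_eq_square)
  moreover have "add (Pt x1 y1) (Pt x2 y2) =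
      Pt ((l^2 - B) / A - x1 - x2) (- (y1 + l * ((l^2 - B) / A - x1 - x2 - x1)))"
    using ne True by (simp add: ec_add_def Let_def l_def)
  ultimately show ?thesis using that by blast
next
  case False
  define l where "l = (y2 - y1) / (x2 - x1)"
  have l: "l * (x1 - x2) = y1 - y2" using False by (simp add: l_def field_simps)
  have "l * (y1 + y2) * (x1 - x2) = y1^2 - y2^2"
    using l by algebra
  also have "\<dots> = (A * (x1^2 + x1*x2 + x2^2) + B * (x1 + x2) + C) * (x1 - x2)"
    using P Q unfolding curve_Pt by algebra
  finally have "slope x1 y1 x2 y2 l"
    using False l unfolding slope_def by simp
  moreover have "add (Pt x1 y1) (Pt x2 y2) =
      Pt ((l^2 - B) / A - x1 - x2) (- (y1 + l * ((l^2 - B) / A - x1 - x2 - x1)))"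
    using False by (simp add: ec_add_def Let_def l_def)
  ultimately show ?thesis using that by blast
qed

lemma add_slope:
  assumes "curve (Pt x1 y1)" "curve (Pt x2 y2)" "\<not> (x1 = x2 \<and> y1 = - y2)"
    and "slope x1 y1 x2 y2 l" and "A * x3 = l^2 - B - A*x1 - A*x2"
  shows "add (Pt x1 y1) (Pt x2 y2) = Pt x3 (- (y1 + l * (x3 - x1)))"
proof -
  obtain m where m: "slope x1 y1 x2 y2 m" "add (Pt x1 y1) (Pt x2 y2) =
      Pt ((m^2 - B) / A - x1 - x2) (- (y1 + m * ((m^2 - B) / A - x1 - x2 - x1)))"
    using slope_exists assms by metis
  moreover have "m = l" using slope_unique m(1) assms by blast
  moreover have "x3 = (l^2 - B) / A - x1 - x2"
    using assms(5) A_nz by (simp add: field_simps)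
  ultimately show ?thesis by simp
qed

lemma add_affine_cases:
  assumes "curve (Pt x1 y1)" "curve (Pt x2 y2)"
  obtains "x1 = x2" "y1 = - y2" "add (Pt x1 y1) (Pt x2 y2) = Infty"
  | l x3 where "\<not> (x1 = x2 \<and> y1 = - y2)" "slope x1 y1 x2 y2 l"
    "A * x3 = l^2 - B - A*x1 - A*x2"
    "add (Pt x1 y1) (Pt x2 y2) = Pt x3 (- (y1 + l * (x3 - x1)))"
proof (cases "x1 = x2 \<and> y1 = - y2")
  case True
  then show ?thesis using that(1) by (simp add: ec_add_def)
next
  case False
  then obtain l where "slope x1 y1 x2 y2 l" "add (Pt x1 y1) (Pt x2 y2) =
      Pt ((l^2 - B) / A - x1 - x2) (- (y1 + l * ((l^2 - B) / A - x1 - x2 - x1)))"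
    using slope_exists assms by metis
  then show ?thesis using that(2)[of l "(l^2 - B) / A - x1 - x2"] False A_nz
    by (simp add: field_simps)
qed

lemma add_Infty_left [simp]: "add Infty P = P"
  by (simp add: ec_add_def)

lemma add_Infty_right [simp]: "add P Infty = P"
  by (cases P) (simp_all add: ec_add_def)

lemma curve_neg: "curve P \<Longrightarrow> curve (neg P)"
  by (cases P) (simp_all add: curve_Pt)

lemma add_neg_left: "add (neg P) P = Infty"
  by (cases P) (simp_all add: ec_add_def)

lemma neg_neg [simp]: "neg (neg P) = P"
  by (cases P) simp_all

lemma add_commute:
  assumes "curve P" "curve Q"
  shows "add P Q = add Q P"
proof (cases P; cases Q)
  fix x1 y1 x2 y2 assume [simp]: "P = Pt x1 y1" "Q = Pt x2 y2"
  from assms have on: "curve (Pt x1 y1)" "curve (Pt x2 y2)" by auto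
  show ?thesis
  proof (cases rule: add_affine_cases[OF on])
    case 1
    then show ?thesis by (simp add: ec_add_def)
  next
    case (2 l x3)
    have "add (Pt x2 y2) (Pt x1 y1) = Pt x3 (- (y2 + l * (x3 - x2)))"
      using 2 slope_commute by (intro add_slope on) (auto simp: algebra_simps)
    moreover have "y2 + l * (x3 - x2) = y1 + l * (x3 - x1)"
      using 2(2) unfolding slope_def by algebra
    ultimately show ?thesis using 2 by simp
  qed
qed auto

text \<open>Reflecting the line through the two summands in the x-axis gives the line through the
  sum and the negative of the second summand, hence the slope \<open>- l\<close>.\<close>

lemma slope_third:
  assumes "slope x1 y1 x2 y2 l" "A * x3 = l^2 - B - A*x1 - A*x2"
  shows "slope x3 (- (y1 + l * (x3 - x1))) x2 (- y2) (- l)"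
proof -
  have 1: "y1 = y2 + l * (x1 - x2)" using assms unfolding slope_def by algebra
  have 2: "l * (y1 + y2) = A * (x1^2 + x1*x2 + x2^2) + B * (x1 + x2) + C"
    using assms unfolding slope_def by blast
  have "- l * (- (y1 + l * (x3 - x1)) + (- y2)) = A * (x3^2 + x3*x2 + x2^2) + B * (x3 + x2) + C"
    using 1 2 assms(2) by algebra
  moreover have "- (y1 + l * (x3 - x1)) - (- y2) = - l * (x3 - x2)"
    using 1 by algebra
  ultimately show ?thesis unfolding slope_def by blast
qed

lemma curve_third:
  assumes "curve (Pt x1 y1)" "slope x1 y1 x2 y2 l" "A * x3 = l^2 - B - A*x1 - A*x2"
  shows "curve (Pt x3 (- (y1 + l * (x3 - x1))))"
proof -
  have 1: "y1 = y2 + l * (x1 - x2)" using assms unfolding slope_def by algebra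
  have 2: "l * (y1 + y2) = A * (x1^2 + x1*x2 + x2^2) + B * (x1 + x2) + C"
    using assms unfolding slope_def by blast
  have 3: "y1^2 = A*x1^3 + B*x1^2 + C*x1 + 1" using assms(1) by (simp add: curve_Pt)
  show ?thesis
    unfolding curve_Pt using 1 2 3 assms(3) by algebra
qed

lemma curve_add:
  assumes "curve P" "curve Q"
  shows "curve (add P Q)"
proof (cases P; cases Q)
  fix x1 y1 x2 y2 assume [simp]: "P = Pt x1 y1" "Q = Pt x2 y2"
  from assms have on: "curve (Pt x1 y1)" "curve (Pt x2 y2)" by auto
  show ?thesis
  proof (cases rule: add_affine_cases[OF on])
    case (2 l x3)
    then show ?thesis using curve_third[OF on(1) 2(2,3)] by simp
  qed simp
qed (use assms in auto)

text \<open>The tangent at a 2-torsion point is vertical: a finite slope would make the derivative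
  vanish at a root of the cubic. Opposite points admitting a slope would be of this kind, which is
  how the vertical case is excluded in later additions.\<close>

lemma no_slope_double_zero:
  assumes "curve (Pt x 0)" "slope x 0 x 0 l"
  shows False
  using smooth[of x] assms unfolding curve_Pt slope_def
  by (simp add: algebra_simps power2_eq_square)

lemma add_cancel:
  assumes "curve P" "curve Q"
  shows "add (add P Q) (neg Q) = P"
proof (cases P; cases Q)
  fix x1 y1 x2 y2 assume [simp]: "P = Pt x1 y1" "Q = Pt x2 y2"
  from assms have on: "curve (Pt x1 y1)" "curve (Pt x2 y2)" by auto
  show ?thesis
  proof (cases rule: add_affine_cases[OF on])
    case 1
    then show ?thesis by simp
  next
    case (2 l x3)
    define y3 where "y3 = - (y1 + l * (x3 - x1))"
    have on3: "curve (Pt x3 y3)" unfolding y3_def using curve_third on 2 by blast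
    have sl: "slope x3 y3 x2 (- y2) (- l)"
      using slope_third 2 unfolding y3_def by blast
    have on2: "curve (Pt x2 (- y2))" using curve_neg[OF on(2)] by simp
    have ne: "\<not> (x3 = x2 \<and> y3 = - (- y2))"
    proof
      assume eq: "x3 = x2 \<and> y3 = - (- y2)"
      then have "y2 + y2 = 0" using sl unfolding slope_def by simp
      then have "y2 = 0" by simp
      then show False using no_slope_double_zero[of x2 "- l"] sl eq on by simp
    qed
    have "add (Pt x3 y3) (Pt x2 (- y2)) = Pt x1 (- (y3 + (- l) * (x1 - x3)))"
      using 2(3) by (intro add_slope on3 on2 ne sl) (simp add: algebra_simps)
    also have "\<dots> = Pt x1 y1" by (simp add: y3_def algebra_simps)
    finally show ?thesis using 2 by (simp add: y3_def)
  qed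
qed (use assms in \<open>auto simp: ec_add_def\<close>)

text \<open>With \<open>l\<close>, \<open>m\<close> the slopes of the lines through $P_1, P_2$ and $P_2, P_3$, the line
  through $P_1 + P_2$ and $P_3$ has slope \<open>k - l\<close>. The line through $P_2 + P_3$ and $P_1$ has
  slope \<open>k - m\<close> with the same \<open>k\<close>, which makes both triple sums equal.\<close>
lemma slope_sum:
  assumes l: "slope x1 y1 x2 y2 l" and m: "slope x2 y2 x3 y3 m"
    and x12: "A * x12 = l^2 - B - A*x1 - A*x2"
    and k: "k * (l - m) = A * (x1 - x3)" and lm: "l \<noteq> m"
  shows "slope x12 (- (y1 + l * (x12 - x1))) x3 y3 (k - l)"
proof -
  have y1: "y1 = y2 + l * (x1 - x2)" using l unfolding slope_def by algebra
  have y3: "y3 = y2 + m * (x3 - x2)" using m unfolding slope_def by algebra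
  have l2: "l * (y1 + y2) = A * (x1^2 + x1*x2 + x2^2) + B * (x1 + x2) + C"
    using l unfolding slope_def by blast
  have m2: "m * (y2 + y3) = A * (x2^2 + x2*x3 + x3^2) + B * (x2 + x3) + C"
    using m unfolding slope_def by blast
  have "(l - m) * (k * (x3 - x12)) = A * (x1 - x3) * (x3 - x12)"
    using k by algebra
  also have "\<dots> = (l - m) * (2 * y2 + (l + m) * (x3 - x2))"
    using x12 l2 m2 unfolding y1 y3 by algebra
  finally have U: "k * (x3 - x12) = 2 * y2 + (l + m) * (x3 - x2)"
    using lm by simp
  have 1: "- (y1 + l * (x12 - x1)) - y3 = (k - l) * (x12 - x3)"
    using U unfolding y1 y3 by algebra
  have 2: "(k - l) * (- (y1 + l * (x12 - x1)) + y3) =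
      A * (x12^2 + x12*x3 + x3^2) + B * (x12 + x3) + C"
    using U x12 k m2 unfolding y1 y3 by algebra
  from 1 2 show ?thesis unfolding slope_def by blast
qed

text \<open>Opposite neighbours and the cases \<open>P = R\<close> and \<open>P = neg R\<close>
  reduce to cancellation and commutativity. What remains has distinct \<open>x1\<close>,
  \<open>x3\<close> and affine inner sums. If the two slopes agree, the points are collinear and
  both sides are \<open>Infty\<close>; otherwise \<open>slope_sum\<close> applies on either side
  with one common \<open>k\<close>.\<close>

lemma add_assoc:
  assumes "curve P" "curve Q" "curve R"
  shows "add (add P Q) R = add P (add Q R)"
proof (cases P; cases Q; cases R)
  fix x1 y1 x2 y2 x3 y3 assume PQR [simp]: "P = Pt x1 y1" "Q = Pt x2 y2" "R = Pt x3 y3"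
  from assms have on: "curve (Pt x1 y1)" "curve (Pt x2 y2)" "curve (Pt x3 y3)" by auto
  have cancel': "add (neg U) (add U V) = V" if "curve U" "curve V" for U V
    using add_cancel[OF that(2,1)] add_commute curve_add curve_neg that by metis
  show ?thesis
  proof (cases rule: add_affine_cases[OF on(1,2)])
    case 1
    then have "add (add P Q) R = R" by simp
    moreover have "add P (add Q R) = R" using cancel'[OF assms(2,3)] 1 by simp
    ultimately show ?thesis by simp
  next
    case PQ: (2 l x12)
    show ?thesis
    proof (cases rule: add_affine_cases[OF on(2,3)])
      case 1
      then have "neg Q = R" by simp
      then have "add (add P Q) R = P" using add_cancel[OF assms(1,2)] by simp
      moreover have "add P (add Q R) = P" using 1 by simp
      ultimately show ?thesis by simp
    next
      case QR: (2 m x23)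
      consider "P = R" | "P = neg R" | "x1 \<noteq> x3"
        using curve_same_x on by fastforce
      then show ?thesis
      proof cases
        assume "P = R"
        then show ?thesis using add_commute assms curve_add by metis
      next
        assume P: "P = neg R"
        have "add (add P Q) R = Q"
          using add_cancel[OF assms(2) curve_neg[OF assms(3)]] add_commute assms P
          by (metis neg_neg)
        moreover have "add P (add Q R) = Q"
          using add_cancel[OF assms(2,3)] add_commute assms P curve_add by metis
        ultimately show ?thesis by simp
      next
        assume x13: "x1 \<noteq> x3"
        define y12 where "y12 = - (y1 + l * (x12 - x1))"
        define y23 where "y23 = - (y3 + m * (x23 - x3))"
        have y1: "y1 = y2 + l * (x1 - x2)" using PQ(2) unfolding slope_def by algebra
        have y3: "y3 = y2 + m * (x3 - x2)" using QR(2) unfolding slope_def by algebra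
        have y23': "- (y2 + m * (x23 - x2)) = y23"
          unfolding y23_def y3 by (simp add: algebra_simps)
        have s12: "add P Q = Pt x12 y12" using PQ by (simp add: y12_def)
        have s23: "add Q R = Pt x23 y23" using QR y23' by simp
        have on12: "curve (Pt x12 y12)" using curve_add[OF assms(1,2)] s12 by simp
        have on23: "curve (Pt x23 y23)" using curve_add[OF assms(2,3)] s23 by simp
        have l2: "l * (y1 + y2) = A * (x1^2 + x1*x2 + x2^2) + B * (x1 + x2) + C"
          using PQ(2) unfolding slope_def by blast
        have m2: "m * (y2 + y3) = A * (x2^2 + x2*x3 + x3^2) + B * (x2 + x3) + C"
          using QR(2) unfolding slope_def by blast
        show ?thesis
        proof (cases "l = m")
          case True
          have "A * (x1 - x3) * (x3 - x12) = 0"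
            using l2 m2 PQ(3) True unfolding y1 y3 by algebra
          then have e12: "x12 = x3" using A_nz x13 by simp
          have "A * (x1 - x3) * (x1 - x23) = 0"
            using l2 m2 QR(3) True unfolding y1 y3 by algebra
          then have e23: "x23 = x1" using A_nz x13 by simp
          have "y12 = - y3" unfolding y12_def y1 y3 e12 True by (simp add: algebra_simps)
          moreover have "y23 = - y1" unfolding y23_def y1 y3 e23 True by (simp add: algebra_simps)
          ultimately show ?thesis using s12 s23 e12 e23 by (simp add: ec_add_def)
        next
          case False
          define k where "k = A * (x1 - x3) / (l - m)"
          have k: "k * (l - m) = A * (x1 - x3)" using False by (simp add: k_def)
          have sl12: "slope x12 y12 x3 y3 (k - l)"
            unfolding y12_def using slope_sum[OF PQ(2) QR(2) PQ(3) k False] .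
          have x23': "A * x23 = m^2 - B - A*x3 - A*x2" using QR(3) by (simp add: algebra_simps)
          have k': "k * (m - l) = A * (x3 - x1)" using k by (simp add: algebra_simps)
          have sl23: "slope x23 y23 x1 y1 (k - m)"
            unfolding y23_def
            using slope_sum[OF slope_commute[OF QR(2)] slope_commute[OF PQ(2)] x23' k'] False by simp
          have aux: "\<not> (x = x' \<and> y = - y')"
            if "slope x y x' y' n" "curve (Pt x y)" for x y x' y' n
          proof
            assume eq: "x = x' \<and> y = - y'"
            then have "y + y = 0" using that(1) unfolding slope_def by simp
            then have "y = 0" by simp
            then show False using no_slope_double_zero[of x n] that eq by simp
          qed
          \<comment> \<open>The abscissa belonging to the slope \<open>k - l\<close>, after
            substituting \<open>x12\<close> and replacing A (x1 - x3) by k (l - m). The result is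
            symmetric in \<open>l\<close> and \<open>m\<close>, so it also belongs to the slope
            \<open>k - m\<close>.\<close>
          define X where "X = x2 + k * (k - l - m) / A"
          have X: "A * X = A * x2 + k * (k - l - m)" using A_nz by (simp add: X_def field_simps)
          have "A * X = (k - l)^2 - B - A * x12 - A * x3"
            using X PQ(3) k by algebra
          then have L: "add (Pt x12 y12) (Pt x3 y3) = Pt X (- (y12 + (k - l) * (X - x12)))"
            using aux[OF sl12 on12] by (intro add_slope on12 on sl12) auto
          have "A * X = (k - m)^2 - B - A * x23 - A * x1"
            using X QR(3) k by algebra
          then have M: "add (Pt x23 y23) (Pt x1 y1) = Pt X (- (y23 + (k - m) * (X - x23)))"
            using aux[OF sl23 on23] by (intro add_slope on23 on sl23) auto
          have "A * (y12 + (k - l) * (X - x12)) = A * (y3 + (k - l) * (X - x3))"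
            using sl12 unfolding slope_def by algebra
          also have "\<dots> = A * (y1 + (k - m) * (X - x1))"
            using X k unfolding y1 y3 by algebra
          also have "\<dots> = A * (y23 + (k - m) * (X - x23))"
            using sl23 unfolding slope_def by algebra
          finally have "add (Pt x12 y12) (Pt x3 y3) = add (Pt x23 y23) (Pt x1 y1)"
            using L M A_nz by simp
          then show ?thesis using s12 s23 add_commute[OF on(1) on23] by simp
        qed
      qed
    qed
  qed
qed auto

end

section \<open>The group of points over a subfield\<close>

locale subfield_of =
  fixes K :: "'a::field_char_0 set"
  assumes K_one: "1 \<in> K"
    and K_add: "x \<in> K \<Longrightarrow> y \<in> K \<Longrightarrow> x + y \<in> K"
    and K_mult: "x \<in> K \<Longrightarrow> y \<in> K \<Longrightarrow> x * y \<in> K"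
    and K_uminus: "x \<in> K \<Longrightarrow> - x \<in> K"
    and K_inverse: "x \<in> K \<Longrightarrow> inverse x \<in> K"
begin

lemma K_diff: "x \<in> K \<Longrightarrow> y \<in> K \<Longrightarrow> x - y \<in> K"
  using K_add[of x "- y"] K_uminus[of y] by simp

lemma K_divide: "x \<in> K \<Longrightarrow> y \<in> K \<Longrightarrow> x / y \<in> K"
  using K_mult[of x "inverse y"] K_inverse[of y] by (simp add: divide_inverse)

lemma K_zero: "0 \<in> K"
  using K_diff[OF K_one K_one] by simp

lemma K_power: "x \<in> K \<Longrightarrow> x ^ n \<in> K"
  by (induction n) (auto intro: K_one K_mult)

lemma K_of_nat: "of_nat n \<in> K"
  by (induction n) (auto intro: K_zero K_one K_add)

lemma K_numeral: "numeral n \<in> K"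
  using K_of_nat[of "numeral n"] by simp

lemmas K_intros = K_zero K_one K_numeral K_add K_mult K_uminus K_diff K_divide K_power

end

text \<open>\<open>K\<close> is a subset of the ambient field, so the group laws are inherited from
  \<open>triple_curve\<close>, and only closure under addition and negation is left.\<close>

locale triple_curve_over = triple_curve a b c + subfield_of K
  for a b c :: "'a::field_char_0" and K +
  assumes a_in: "a \<in> K" and b_in: "b \<in> K" and c_in: "c \<in> K"
begin

abbreviation E where "E \<equiv> ec_group K a b c"

lemma coeffs_in: "A \<in> K" "B \<in> K" "C \<in> K"
  unfolding cubA_def cubB_def cubC_def by (intro K_intros a_in b_in c_in)+

lemma points_iff [simp]:
  "Infty \<in> ec_points K a b c"
  "Pt x y \<in> ec_points K a b c \<longleftrightarrow> curve (Pt x y) \<and> x \<in> K \<and> y \<in> K"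
  by (simp_all add: ec_points_def)

lemma points_curve: "P \<in> ec_points K a b c \<Longrightarrow> curve P"
  by (simp add: ec_points_def)

lemma E_simps [simp]:
  "carrier E = ec_points K a b c" "P \<otimes>\<^bsub>E\<^esub> Q = add P Q" "\<one>\<^bsub>E\<^esub> = Infty"
  by (simp_all add: ec_group_def)

lemma points_neg: "P \<in> ec_points K a b c \<Longrightarrow> neg P \<in> ec_points K a b c"
  by (cases P) (auto simp: curve_Pt intro: K_uminus)

lemma points_add:
  assumes "P \<in> ec_points K a b c" "Q \<in> ec_points K a b c"
  shows "add P Q \<in> ec_points K a b c"
proof -
  have "case add P Q of Infty \<Rightarrow> True | Pt x y \<Rightarrow> x \<in> K \<and> y \<in> K"
    using assms unfolding ec_add_def Let_def
    by (auto split: ecpt.split intro!: K_intros coeffs_in)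
  moreover have "curve (add P Q)"
    using curve_add points_curve assms by blast
  ultimately show ?thesis by (simp add: ec_points_def)
qed

lemma comm_group_E: "comm_group E"
proof (rule comm_groupI)
  show "\<exists>Q\<in>carrier E. Q \<otimes>\<^bsub>E\<^esub> P = \<one>\<^bsub>E\<^esub>" if "P \<in> carrier E" for P
    using that add_neg_left[of P] points_neg by auto
  show "P \<otimes>\<^bsub>E\<^esub> Q \<otimes>\<^bsub>E\<^esub> R = P \<otimes>\<^bsub>E\<^esub> (Q \<otimes>\<^bsub>E\<^esub> R)"
    if "P \<in> carrier E" "Q \<in> carrier E" "R \<in> carrier E" for P Q R
    using that points_curve add_assoc by simp
  show "P \<otimes>\<^bsub>E\<^esub> Q = Q \<otimes>\<^bsub>E\<^esub> P" if "P \<in> carrier E" "Q \<in> carrier E" for P Q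
    using that points_curve add_commute by simp
qed (use points_add in auto)

sublocale E: comm_group E
  by (rule comm_group_E)

lemma ec_mult_eq_pow: "P \<in> ec_points K a b c \<Longrightarrow> ec_mult a b c n P = P [^]\<^bsub>E\<^esub> n"
proof (induction n)
  case (Suc n)
  then show ?case using E.nat_pow_Suc2[of P n] by simp
qed simp

lemma ec_torsion_eq:
  "ec_torsion K a b c = {P \<in> ec_points K a b c. \<exists>n::nat. n \<ge> 1 \<and> P [^]\<^bsub>E\<^esub> n = \<one>\<^bsub>E\<^esub>}"
  using ec_mult_eq_pow unfolding ec_torsion_def by auto

end

section \<open>A criterion for the 4-torsion of an abelian group to be Z/4 x Z/4\<close>

lemma group_Z4xZ4: "group Z4xZ4"
  unfolding Z4xZ4_def by (intro DirProd_group group_integer_mod_group)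

context comm_group
begin

text \<open>A relation between involutions depends only on the parities of the exponents, so it
  suffices that \<open>t1\<close>, \<open>t2\<close> and their product are nontrivial.\<close>

lemma independent_involutions_even:
  assumes t: "t1 \<in> carrier G" "t2 \<in> carrier G" "t1 [^] (2::int) = \<one>" "t2 [^] (2::int) = \<one>"
    and ne: "t1 \<noteq> \<one>" "t2 \<noteq> \<one>" "t1 \<noteq> t2"
    and eq: "t1 [^] (m::int) \<otimes> t2 [^] (n::int) = \<one>"
  shows "even m \<and> even n"
proof -
  have red: "u [^] k = (if even k then \<one> else u)"
    if "u \<in> carrier G" "u [^] (2::int) = \<one>" for u and k :: int
  proof -
    have "u [^] k = u [^] (2 * (k div 2) + k mod 2)" by simp
    also have "\<dots> = (u [^] (2::int)) [^] (k div 2) \<otimes> u [^] (k mod 2)"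
      by (simp only: int_pow_mult int_pow_pow that(1))
    also have "\<dots> = (if even k then \<one> else u)"
      using that by (auto simp: even_iff_mod_2_eq_zero odd_iff_mod_2_eq_one int_pow_1)
    finally show ?thesis .
  qed
  have "t1 \<otimes> t2 \<noteq> \<one>"
  proof
    assume "t1 \<otimes> t2 = \<one>"
    moreover have "t2 \<otimes> t2 = \<one>"
      using t(4) int_pow_mult[OF t(2), of 1 1] t(2) by (simp add: int_pow_1)
    ultimately show False using t ne by (metis right_cancel)
  qed
  then show ?thesis using eq t ne red[OF t(1,3), of m] red[OF t(2,4), of n]
    by (auto split: if_splits)
qed

text \<open>Injectivity comes from the independence of the two squares. For surjectivity, the square
  of a 4-torsion element is 2-torsion, hence the square of some product of powers of
  \<open>q1\<close> and \<open>q2\<close>; the element and this product differ by 2-torsion, which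
  again consists of such products.\<close>

lemma Z4xZ4_iso_4_torsion:
  assumes q: "q1 \<in> carrier G" "q2 \<in> carrier G" "q1 [^] (4::int) = \<one>" "q2 [^] (4::int) = \<one>"
    and ne: "q1 [^] (2::int) \<noteq> \<one>" "q2 [^] (2::int) \<noteq> \<one>" "q1 [^] (2::int) \<noteq> q2 [^] (2::int)"
    and two: "\<And>x. x \<in> carrier G \<Longrightarrow> x [^] (2::int) = \<one> \<Longrightarrow>
      x \<in> {\<one>, q1 [^] (2::int), q2 [^] (2::int), q1 [^] (2::int) \<otimes> q2 [^] (2::int)}"
  shows "Z4xZ4 \<cong> G\<lparr>carrier := {x \<in> carrier G. x [^] (4::int) = \<one>}\<rparr>"
proof -
  define h where "h = (\<lambda>(i::int, j::int). q1 [^] i \<otimes> q2 [^] j)"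
  let ?H = "G\<lparr>carrier := {x \<in> carrier G. x [^] (4::int) = \<one>}\<rparr>"
  have h_in: "h p \<in> carrier G" for p
    using q by (auto simp: h_def split: prod.split)
  have h_add: "h (i + i', j + j') = h (i, j) \<otimes> h (i', j')" for i i' j j'
    using q by (simp add: h_def int_pow_mult m_ac)
  have h_mult: "h (n * i, n * j) = h (i, j) [^] n" for n i j
    using q by (simp add: h_def int_pow_distrib int_pow_pow mult.commute)
  have h4: "h (4 * i, 4 * j) = \<one>" for i j
    using q by (simp add: h_def flip: int_pow_pow)
  have h_mod: "h (i mod 4, j mod 4) = h (i, j)" for i j
  proof -
    have "h (i, j) = h (i mod 4 + 4 * (i div 4), j mod 4 + 4 * (j div 4))" by simp
    also have "\<dots> = h (i mod 4, j mod 4) \<otimes> h (4 * (i div 4), 4 * (j div 4))" by (rule h_add)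
    also have "\<dots> = h (i mod 4, j mod 4)" using h4 h_in by simp
    finally show ?thesis by simp
  qed
  have tors: "h p [^] (4::int) = \<one>" for p
    using h4 h_mult[of 4 "fst p" "snd p"] by simp
  have h2: "h (2 * i, 2 * j) = (q1 [^] (2::int)) [^] i \<otimes> (q2 [^] (2::int)) [^] j" for i j
    using q by (simp add: h_def int_pow_pow)
  have sq: "(q1 [^] (2::int)) [^] (2::int) = \<one>" "(q2 [^] (2::int)) [^] (2::int) = \<one>"
    using q by (simp_all add: int_pow_pow)
  \<comment> \<open>The squared relation is one between involutions, so \<open>i\<close> and
    \<open>j\<close> are even; after halving, the original relation is itself one between the
    involutions, which gives the second factor 2.\<close>
  have ker: "4 dvd i \<and> 4 dvd j" if "h (i, j) = \<one>" for i j
  proof -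
    have ev: "even m \<and> even n" if "h (2 * m, 2 * n) = \<one>" for m n
      using independent_involutions_even[OF _ _ sq ne] that h2 q by simp
    have "h (2 * i, 2 * j) = \<one>" using h_mult[of 2 i j] that by simp
    then have "even i \<and> even j" by (rule ev)
    then obtain i' j' where ij: "i = 2 * i'" "j = 2 * j'" by (auto elim!: evenE)
    then have "even i' \<and> even j'" using that ev by simp
    then show ?thesis using ij by auto
  qed
  have "h \<in> hom Z4xZ4 ?H"
    using h_in tors h_add h_mod
    by (auto simp: hom_def Z4xZ4_def integer_mod_group_def)
  moreover have "inj_on h (carrier Z4xZ4)"
  proof (rule inj_onI)
    fix p p' assume p: "p \<in> carrier Z4xZ4" "p' \<in> carrier Z4xZ4" and eq: "h p = h p'"
    obtain i j i' j' where [simp]: "p = (i, j)" "p' = (i', j')" by fastforce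
    have "h (i, j) = h (i', j') \<otimes> h (i - i', j - j')"
      using h_add[of i' "i - i'" j' "j - j'"] by simp
    then have "h (i - i', j - j') = \<one>"
      using eq h_in by simp
    then have "4 dvd i - i' \<and> 4 dvd j - j'" by (rule ker)
    moreover have "i \<in> {0..<4}" "j \<in> {0..<4}" "i' \<in> {0..<4}" "j' \<in> {0..<4}"
      using p by (auto simp: Z4xZ4_def carrier_integer_mod_group)
    ultimately show "p = p'" by (simp, presburger)
  qed
  moreover have "h ` carrier Z4xZ4 = carrier ?H"
  proof -
    have "x \<in> h ` carrier Z4xZ4" if x: "x \<in> carrier G" "x [^] (4::int) = \<one>" for x
    proof -
      have two': "\<exists>i j. y = h (2 * i, 2 * j)" if "y \<in> carrier G" "y [^] (2::int) = \<one>" for y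
      proof -
        have "\<one> = h (2 * 0, 2 * 0)" "q1 [^] (2::int) = h (2 * 1, 2 * 0)"
          "q2 [^] (2::int) = h (2 * 0, 2 * 1)" "q1 [^] (2::int) \<otimes> q2 [^] (2::int) = h (2 * 1, 2 * 1)"
          unfolding h2 using q by (simp_all add: int_pow_1)
        then show ?thesis using two[OF that] by blast
      qed
      have "(x [^] (2::int)) [^] (2::int) = \<one>" using x by (simp add: int_pow_pow)
      then obtain i j where ij: "x [^] (2::int) = h (2 * i, 2 * j)"
        using two' x by (meson int_pow_closed)
      define y where "y = x \<otimes> inv (h (i, j))"
      have y: "y \<in> carrier G" using x h_in by (simp add: y_def)
      have "y [^] (2::int) = \<one>"
        using ij h_mult[of 2 i j] x h_in by (simp add: y_def int_pow_distrib int_pow_inv)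
      then obtain k l where "y = h (2 * k, 2 * l)" using two' y by blast
      then have "x = h (2 * k, 2 * l) \<otimes> h (i, j)"
        using x h_in y_def by (metis inv_closed inv_inv inv_solve_right m_comm)
      then have "x = h ((2 * k + i) mod 4, (2 * l + j) mod 4)"
        using h_add h_mod by metis
      then show ?thesis by (auto simp: Z4xZ4_def carrier_integer_mod_group)
    qed
    then show ?thesis using h_in tors by auto
  qed
  ultimately have "h \<in> iso Z4xZ4 ?H" by (simp add: iso_def bij_betw_def)
  then show ?thesis by (auto simp: is_iso_def)
qed

end

section \<open>Valuation rings with residue field of nine elements\<close>

text \<open>\<open>R_inverse\<close> combines two facts: \<open>R\<close> is a valuation ring of
  \<open>K\<close>, and every non-unit is divisible by 3. With \<open>third_notin_R\<close>, the
  maximal ideal is generated by 3. \<open>R_frobenius\<close> places the residue field inside the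
  field with nine elements.\<close>

locale place9 = subfield_of K
  for K :: "'a::field_char_0 set" +
  fixes R :: "'a set"
  assumes R_sub: "x \<in> R \<Longrightarrow> x \<in> K"
    and R_one: "1 \<in> R"
    and R_add: "x \<in> R \<Longrightarrow> y \<in> R \<Longrightarrow> x + y \<in> R"
    and R_mult: "x \<in> R \<Longrightarrow> y \<in> R \<Longrightarrow> x * y \<in> R"
    and R_uminus: "x \<in> R \<Longrightarrow> - x \<in> R"
    and R_inverse: "x \<in> K \<Longrightarrow> x \<notin> R \<Longrightarrow> inverse x / 3 \<in> R"
    and third_notin_R: "1 / 3 \<notin> R"
    and R_frobenius: "x \<in> R \<Longrightarrow> (x ^ 9 - x) / 3 \<in> R"
begin

definition multiples :: "'a \<Rightarrow> 'a set" where
  "multiples u = {u * r |r. r \<in> R}"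

definition res_eq :: "'a \<Rightarrow> 'a \<Rightarrow> bool"  (infix "\<approx>" 50) where
  "x \<approx> y \<longleftrightarrow> x - y \<in> multiples 3"

lemma R_diff: "x \<in> R \<Longrightarrow> y \<in> R \<Longrightarrow> x - y \<in> R"
  using R_add[of x "- y"] R_uminus[of y] by simp

lemma R_zero: "0 \<in> R"
  using R_diff[OF R_one R_one] by simp

lemma R_power: "x \<in> R \<Longrightarrow> x ^ n \<in> R"
  by (induction n) (auto intro: R_one R_mult)

lemma R_of_nat: "of_nat n \<in> R"
  by (induction n) (auto intro: R_zero R_one R_add)

lemma R_numeral: "numeral n \<in> R"
  using R_of_nat[of "numeral n"] by simp

lemmas R_intros = R_zero R_one R_numeral R_add R_mult R_uminus R_diff R_power

lemma multiplesI: "r \<in> R \<Longrightarrow> x = u * r \<Longrightarrow> x \<in> multiples u"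
  unfolding multiples_def by blast

lemma multiplesE:
  assumes "x \<in> multiples u"
  obtains r where "r \<in> R" "x = u * r"
  using assms unfolding multiples_def by blast

lemma multiples_zero: "0 \<in> multiples u"
  by (rule multiplesI[OF R_zero]) simp

lemma multiples_self: "u \<in> multiples u"
  by (rule multiplesI[OF R_one]) simp

lemma multiples_one: "multiples 1 = R"
  by (auto simp: multiples_def)

lemma multiples_add: "x \<in> multiples u \<Longrightarrow> y \<in> multiples u \<Longrightarrow> x + y \<in> multiples u"
  unfolding multiples_def using R_add by clarify (metis distrib_left)

lemma multiples_uminus: "x \<in> multiples u \<Longrightarrow> - x \<in> multiples u"
  by (elim multiplesE, rule multiplesI[OF R_uminus]) auto

lemma multiples_diff: "x \<in> multiples u \<Longrightarrow> y \<in> multiples u \<Longrightarrow> x - y \<in> multiples u"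
  using multiples_add[of x u "- y"] multiples_uminus[of y] by simp

lemma multiples_mult: "x \<in> multiples u \<Longrightarrow> y \<in> multiples v \<Longrightarrow> x * y \<in> multiples (u * v)"
  unfolding multiples_def using R_mult by clarify (metis mult.assoc mult.left_commute)

lemma multiples_mult_left: "r \<in> R \<Longrightarrow> x \<in> multiples u \<Longrightarrow> r * x \<in> multiples u"
  using multiples_mult[of r 1 x u] by (simp add: multiples_one)

lemma multiples_mult_right: "x \<in> multiples u \<Longrightarrow> r \<in> R \<Longrightarrow> x * r \<in> multiples u"
  using multiples_mult[of x u r 1] by (simp add: multiples_one)

lemma multiples_power: "x \<in> multiples u \<Longrightarrow> x ^ n \<in> multiples (u ^ n)"
  by (induction n) (auto intro: multiples_mult multiples_self)

lemma multiples_trans: "x \<in> multiples u \<Longrightarrow> u \<in> multiples v \<Longrightarrow> x \<in> multiples v"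
  unfolding multiples_def using R_mult by clarify (metis mult.assoc)

lemma multiples_R: "x \<in> multiples u \<Longrightarrow> u \<in> R \<Longrightarrow> x \<in> R"
  by (elim multiplesE) (auto intro: R_mult)

lemma multiples_cancel: "u \<noteq> 0 \<Longrightarrow> u * x \<in> multiples (u * v) \<Longrightarrow> x \<in> multiples v"
  by (elim multiplesE, rule multiplesI) auto

lemma multiples3_R: "x \<in> multiples 3 \<Longrightarrow> x \<in> R"
  using multiples_R R_numeral by blast

lemma one_notin_multiples3: "1 \<notin> multiples 3"
proof
  assume "1 \<in> multiples (3::'a)"
  then obtain r where r: "r \<in> R" "1 = 3 * r" by (rule multiplesE)
  then have "1 / 3 = r" by (metis nonzero_mult_div_cancel_left zero_neq_numeral)
  then show False using r(1) third_notin_R by metis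
qed

lemma inverse_in_multiples3: "x \<in> K \<Longrightarrow> x \<notin> R \<Longrightarrow> inverse x \<in> multiples 3"
  using R_inverse[of x] by (intro multiplesI[of "inverse x / 3"]) auto

lemma unit_inverse:
  assumes "x \<in> R" "x \<notin> multiples 3"
  shows "inverse x \<in> R"
  using inverse_in_multiples3[of "inverse x"] assms R_sub K_inverse by fastforce

lemma unit_nz: "x \<notin> multiples 3 \<Longrightarrow> x \<noteq> 0"
  using multiples_zero by blast

lemma notin_R_if_inverse:
  assumes "inverse x \<in> multiples 3" "x \<noteq> 0"
  shows "x \<notin> R"
  using multiples_mult_left[of x "inverse x" 3] assms one_notin_multiples3 by auto

lemma multiples3_prime:
  assumes "x \<in> R" "y \<in> R" "x * y \<in> multiples 3"
  shows "x \<in> multiples 3 \<or> y \<in> multiples 3"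
proof (rule ccontr)
  assume neg: "\<not> ?thesis"
  then have "inverse x * (x * y) \<in> multiples 3"
    using assms unit_inverse multiples_mult_left by blast
  moreover have "x \<noteq> 0" using neg unit_nz by blast
  ultimately show False using neg by (simp flip: mult.assoc)
qed

lemma multiples3_power:
  assumes "x \<in> R" "x ^ n \<in> multiples 3"
  shows "x \<in> multiples 3"
  using assms(2)
proof (induction n)
  case 0
  then show ?case using one_notin_multiples3 by simp
next
  case (Suc n)
  then show ?case using multiples3_prime[of x "x ^ n"] assms(1) R_power by auto
qed

text \<open>Valuation rings are integrally closed: outside \<open>R\<close> the inverse lies in the
  maximal ideal, and so does its power. This makes ordinates and slopes integral as soon as their
  squares are.\<close>

lemma power_in_R:
  assumes "x \<in> K" "x ^ n \<in> R" "n > 0"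
  shows "x \<in> R"
proof (rule ccontr)
  assume x: "x \<notin> R"
  then have "inverse x \<in> multiples 3" using assms inverse_in_multiples3 by blast
  then have "inverse x * inverse x ^ (n - 1) \<in> multiples 3"
    by (intro multiples_mult_right R_power multiples3_R)
  then have "inverse x ^ n \<in> multiples 3"
    using assms(3) by (simp flip: power_Suc)
  then have "inverse (x ^ n) \<in> multiples 3" by (simp add: power_inverse)
  moreover have "x ^ n \<noteq> 0" using x R_zero by auto
  ultimately show False using notin_R_if_inverse assms(2) by blast
qed

text \<open>The numbers 1 and 2 are units, so divisibility of a natural number by 3 in
  \<open>R\<close> already holds among the naturals; cancelling one factor 3 and repeating gives
  divisibility by 9.\<close>

lemma of_nat_notin_multiples9:
  assumes "\<not> 9 dvd n"
  shows "of_nat n \<notin> multiples (9::'a)"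
proof
  assume n9: "of_nat n \<in> multiples (9::'a)"
  have unit: "\<not> of_nat m \<in> multiples (3::'a)" if "\<not> 3 dvd m" for m
  proof
    assume m: "of_nat m \<in> multiples (3::'a)"
    have "m = 3 * (m div 3) + m mod 3" by simp
    then have "of_nat m = 3 * of_nat (m div 3) + (of_nat (m mod 3) :: 'a)"
      by (metis of_nat_add of_nat_mult of_nat_numeral)
    moreover have "3 * of_nat (m div 3) \<in> multiples (3::'a)" by (rule multiplesI[OF R_of_nat]) simp
    ultimately have r: "of_nat (m mod 3) \<in> multiples (3::'a)"
      using multiples_diff[OF m] by (metis add_diff_cancel_left')
    have "m mod 3 = 1 \<or> m mod 3 = 2" using that by presburger
    then show False
    proof
      assume "m mod 3 = 2"
      then have "3 - 2 \<in> multiples (3::'a)" using r multiples_diff[OF multiples_self] by fastforce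
      then show False using one_notin_multiples3 by simp
    qed (use r one_notin_multiples3 in simp)
  qed
  have "(9::'a) \<in> multiples 3" by (rule multiplesI[OF R_numeral[of "num.Bit1 num.One"]]) simp
  then have "of_nat n \<in> multiples (3::'a)" using n9 multiples_trans by blast
  then have "3 dvd n" using unit by blast
  then obtain m where m: "n = 3 * m" by blast
  then have "3 * of_nat m \<in> multiples (3 * 3 :: 'a)" using n9 by simp
  then have "of_nat m \<in> multiples (3::'a)" using multiples_cancel[of 3 "of_nat m" 3] by simp
  then have "3 dvd m" using unit by blast
  then show False using assms m by auto
qed

lemma res_eq_refl [simp]: "x \<approx> x"
  by (simp add: res_eq_def multiples_zero)

lemma res_eq_sym: "x \<approx> y \<Longrightarrow> y \<approx> x"
  using multiples_uminus[of "x - y" 3] by (simp add: res_eq_def)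

lemma res_eq_trans [trans]: "x \<approx> y \<Longrightarrow> y \<approx> z \<Longrightarrow> x \<approx> z"
  using multiples_add[of "x - y" 3 "y - z"] by (simp add: res_eq_def)

lemma res_eq_add: "x \<approx> y \<Longrightarrow> x' \<approx> y' \<Longrightarrow> x + x' \<approx> y + y'"
  using multiples_add[of "x - y" 3 "x' - y'"] by (simp add: res_eq_def algebra_simps)

lemma res_eq_diff: "x \<approx> y \<Longrightarrow> x' \<approx> y' \<Longrightarrow> x - x' \<approx> y - y'"
  using multiples_diff[of "x - y" 3 "x' - y'"] by (simp add: res_eq_def algebra_simps)

lemma res_eq_mult:
  assumes "x \<approx> y" "x' \<approx> y'" "x \<in> R" "y' \<in> R"
  shows "x * x' \<approx> y * y'"
proof -
  have "x * (x' - y') + (x - y) * y' \<in> multiples 3"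
    using assms unfolding res_eq_def
    by (intro multiples_add multiples_mult_left multiples_mult_right)
  then show ?thesis unfolding res_eq_def by (simp add: algebra_simps)
qed

lemma res_eq_R: "x \<approx> y \<Longrightarrow> y \<in> R \<Longrightarrow> x \<in> R"
  using multiples3_R[of "x - y"] R_add[of "x - y" y] by (simp add: res_eq_def)

lemma res_eq_power: "x \<approx> y \<Longrightarrow> y \<in> R \<Longrightarrow> x ^ n \<approx> y ^ n"
proof (induction n)
  case (Suc n)
  then show ?case using res_eq_mult[of x y "x ^ n" "y ^ n"] R_power res_eq_R by simp
qed simp

lemma res_eq_zero_iff: "x \<approx> 0 \<longleftrightarrow> x \<in> multiples 3"
  by (simp add: res_eq_def)

lemma res_eq_3: "x = y + 3 * r \<Longrightarrow> r \<in> R \<Longrightarrow> x \<approx> y"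
  unfolding res_eq_def by (rule multiplesI) auto

lemma res_eq_notin: "x \<approx> y \<Longrightarrow> y \<notin> multiples 3 \<Longrightarrow> x \<notin> multiples 3"
  using multiples_diff[of x 3 "x - y"] by (auto simp: res_eq_def)

lemma res_eq_1_unit: "x \<approx> 1 \<Longrightarrow> x \<in> R \<and> x \<notin> multiples 3 \<and> x \<noteq> 0 \<and> inverse x \<in> R"
  using res_eq_notin one_notin_multiples3 res_eq_R R_one unit_nz unit_inverse by blast

end

section \<open>The kernel of reduction is torsion-free\<close>

text \<open>The congruences say that the reduction is y^2 = x^3 + x + 1. In characteristic 3 a cubic
  without square term yields a supersingular curve, and its derivative is constant.\<close>

locale supersingular_triple_curve = triple_curve_over a b c K + place9 K R
  for a b c :: "'a::field_char_0" and K R +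
  assumes A_res: "cubA a b c \<approx> 1" and B_res: "cubB a b c \<approx> 0" and C_res: "cubC a b c \<approx> 1"
begin

lemma coeffs_R: "A \<in> R" "B \<in> R" "C \<in> R"
  using A_res B_res C_res res_eq_R R_one R_zero by blast+

abbreviation pts where "pts \<equiv> ec_points K a b c"

text \<open>The local parameter at infinity, whence the value 0 at \<open>Infty\<close>. Affine
  points of \<open>formal_nbhd\<close> have nonzero ordinate, so the quotient is genuine
  there.\<close>

fun zcoord :: "'a ecpt \<Rightarrow> 'a" where
  "zcoord Infty = 0"
| "zcoord (Pt x y) = x / y"

definition reduces_to_Infty :: "'a ecpt set" where
  "reduces_to_Infty = {P \<in> pts. case P of Infty \<Rightarrow> True | Pt x y \<Rightarrow> x \<notin> R}"

text \<open>The filtration of the kernel of reduction, indexed by an element \<open>z\<close>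
  instead of an exponent, since not every element of \<open>R\<close> need be a unit times a power
  of 3. The cube reflects that w = 1/y vanishes to order three at infinity.\<close>

definition formal_nbhd :: "'a \<Rightarrow> 'a ecpt set" where
  "formal_nbhd z = {P \<in> pts. case P of Infty \<Rightarrow> True
     | Pt x y \<Rightarrow> y \<noteq> 0 \<and> x / y \<in> multiples z \<and> 1 / y \<in> multiples (z ^ 3)}"

text \<open>Vieta's formulas for A x^3 + (B - l^2) x^2 + (C - 2 l n) x + 1 - n^2, the cubic cut out
  by the line y = l x + n. The assumption on \<open>x3\<close> is the formula for the sum of the
  roots.\<close>

lemma slope_vieta:
  assumes on: "curve (Pt x1 y1)" and sl: "slope x1 y1 x2 y2 l"
    and x3: "A * x3 = l^2 - B - A*x1 - A*x2" and n: "n = y1 - l * x1"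
  shows "C - 2*l*n = A * (x1*x2 + x1*x3 + x2*x3)" and "n^2 - 1 = A * (x1*x2*x3)"
proof -
  have 1: "y2 = y1 - l * (x1 - x2)" using sl unfolding slope_def by algebra
  have 2: "l * (y1 + y2) = A * (x1^2 + x1*x2 + x2^2) + B * (x1 + x2) + C"
    using sl unfolding slope_def by blast
  have 3: "y1^2 = A*x1^3 + B*x1^2 + C*x1 + 1" using on by (simp add: curve_Pt)
  show e2: "C - 2*l*n = A * (x1*x2 + x1*x3 + x2*x3)"
    using 1 2 x3 n by algebra
  show "n^2 - 1 = A * (x1*x2*x3)"
    using e2 3 x3 n by algebra
qed

text \<open>With z = x/y and w = 1/y the curve is w = A z^3 + B z^2 w + C z w^2 + w^3 and the line
  is 1 = l z + n w. The claim is the difference quotient of the first equation with (w1 - w2)/(z1 -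
  z2) = - l/n, cleared of \<open>n\<close>; in this form it covers tangents as well.\<close>

lemma slope_chart_at_infinity:
  assumes on: "curve (Pt x1 y1)" "curve (Pt x2 y2)" and ne: "\<not> (x1 = x2 \<and> y1 = - y2)"
    and sl: "slope x1 y1 x2 y2 l" and y: "y1 \<noteq> 0" "y2 \<noteq> 0"
    and z: "z1 = x1 / y1" "z2 = x2 / y2" "w1 = 1 / y1" "w2 = 1 / y2" and n: "n = y1 - l * x1"
  shows "l * (1 - B * z2^2 - C * z2 * (w1 + w2) - (w1^2 + w1*w2 + w2^2)) +
         n * (A * (z1^2 + z1*z2 + z2^2) + B * (z1 + z2) * w1 + C * w1^2) = 0" (is "?L = 0")
proof -
  have on1: "y1^2 = A*x1^3 + B*x1^2 + C*x1 + 1" and on2: "y2^2 = A*x2^3 + B*x2^2 + C*x2 + 1"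
    using on by (simp_all add: curve_Pt)
  have n2: "n = y2 - l * x2" using sl n unfolding slope_def by algebra
  have "?L * (y1^2 * y2^2) =
      l * (y1^2*y2^2 - B*x2^2*y1^2 - C*x2*(y1*y2 + y1^2) - (y2^2 + y1*y2 + y1^2)) +
      n * (A*(x1^2*y2^2 + x1*x2*y1*y2 + x2^2*y1^2) + B*(x1*y2^2 + x2*y1*y2) + C*y2^2)"
    using y unfolding z by (simp add: field_simps power2_eq_square)
  also have "\<dots> = 0"
  proof (cases "x1 = x2")
    case True
    then have y12: "y1 = y2" using curve_same_x on ne by metis
    have t: "l * (2 * y1) = 3 * A * x1^2 + 2 * B * x1 + C"
      using sl True y12 unfolding slope_def by algebra
    show ?thesis using t on1 n unfolding True[symmetric] y12[symmetric] by algebra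
  next
    case False
    have 1: "l * (x1 - x2) = y1 - y2" using sl unfolding slope_def by simp
    have "(x1 - x2) * (l * (y1^2*y2^2 - B*x2^2*y1^2 - C*x2*(y1*y2 + y1^2) - (y2^2 + y1*y2 + y1^2)) +
      n * (A*(x1^2*y2^2 + x1*x2*y1*y2 + x2^2*y1^2) + B*(x1*y2^2 + x2*y1*y2) + C*y2^2)) = 0"
      using 1 on1 on2 n n2 by algebra
    then show ?thesis using False by simp
  qed
  finally show ?thesis using y by simp
qed

text \<open>In the chart $z = x/y$, $w = 1/y$ at infinity the group law is addition of the
  $z$-coordinates up to terms of order three; there is no term of order two because inversion is
  $z \<mapsto> -z$. A cubic error suffices since 3 generates the maximal ideal.\<close>
lemma formal_add:
  assumes z0: "z0 \<in> multiples 3" and P: "P \<in> formal_nbhd z0" and Q: "Q \<in> formal_nbhd z0"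
  shows "add P Q \<in> formal_nbhd z0 \<and> zcoord (add P Q) - (zcoord P + zcoord Q) \<in> multiples (z0^3)"
proof (cases P; cases Q)
  fix x1 y1 x2 y2 assume [simp]: "P = Pt x1 y1" "Q = Pt x2 y2"
  have pts: "Pt x1 y1 \<in> pts" "Pt x2 y2 \<in> pts" using P Q by (auto simp: formal_nbhd_def)
  then have on: "curve (Pt x1 y1)" "curve (Pt x2 y2)" by auto
  show ?thesis
  proof (cases rule: add_affine_cases[OF on])
    case 1
    then show ?thesis by (auto simp: formal_nbhd_def multiples_zero)
  next
    case (2 l x3)
    define z1 z2 w1 w2 where zw: "z1 = x1 / y1" "z2 = x2 / y2" "w1 = 1 / y1" "w2 = 1 / y2"
    have y: "y1 \<noteq> 0" "y2 \<noteq> 0" and z: "z1 \<in> multiples z0" "z2 \<in> multiples z0"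
      and w: "w1 \<in> multiples (z0^3)" "w2 \<in> multiples (z0^3)"
      using P Q unfolding zw by (auto simp: formal_nbhd_def)
    have z0R: "z0 \<in> R" using z0 multiples3_R by blast
    have zR: "z1 \<in> R" "z2 \<in> R" "w1 \<in> R" "w2 \<in> R"
      using z w z0R multiples_R R_power by blast+
    have z02: "z0^3 \<in> multiples (z0^2)" "z0^2 \<in> multiples 3" "z0^3 \<in> multiples z0"
      using z0R multiplesI[OF z0R] multiplesI[of "z0^2" "z0^3" z0] multiples_mult_right[OF z0]
      by (auto simp: power2_eq_square power3_eq_cube intro: R_mult)
    have w2: "w1 \<in> multiples (z0^2)" "w2 \<in> multiples (z0^2)"
      using w z02 multiples_trans by blast+
    have z3: "z1 \<in> multiples 3" "z2 \<in> multiples 3" "w1 \<in> multiples 3" "w2 \<in> multiples 3"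
      using z w z0 z02 multiples_trans by blast+
    define n where "n = y1 - l * x1"
    define M where "M = B * z2^2 + C * z2 * (w1 + w2) + (w1^2 + w1*w2 + w2^2)"
    define N where "N = A * (z1^2 + z1*z2 + z2^2) + B * (z1 + z2) * w1 + C * w1^2"
    have chart: "l * (1 - M) + n * N = 0"
      using slope_chart_at_infinity[OF on 2(1,2) y zw n_def] unfolding M_def N_def
      by (simp add: algebra_simps)
    have "M \<in> multiples 3"
      unfolding M_def power2_eq_square
      by (intro multiples_add multiples_mult_left[OF R_mult] multiples_mult_left z3 coeffs_R R_mult zR)
    then have "1 - M \<approx> 1 - 0" by (intro res_eq_diff) (auto simp: res_eq_zero_iff)
    then have M: "1 - M \<noteq> 0" "inverse (1 - M) \<in> R" using res_eq_1_unit[of "1 - M"] by auto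
    have zz: "z1^2 \<in> multiples (z0^2)" "z1 * z2 \<in> multiples (z0^2)" "z2^2 \<in> multiples (z0^2)"
      using multiples_mult[OF z] multiples_mult[OF z(1) z(1)] multiples_mult[OF z(2) z(2)]
      by (auto simp: power2_eq_square)
    have N: "N \<in> multiples (z0^2)"
    proof -
      have "A * (z1^2 + z1*z2 + z2^2) \<in> multiples (z0^2)"
        by (intro multiples_mult_left multiples_add zz coeffs_R)
      moreover have "B * (z1 + z2) * w1 \<in> multiples (z0^2)"
        by (intro multiples_mult_left w2 R_mult R_add coeffs_R zR)
      moreover have "C * (w1 * w1) \<in> multiples (z0^2)"
        by (intro multiples_mult_left w2 coeffs_R zR)
      ultimately show ?thesis
        unfolding N_def power2_eq_square[of w1] by (intro multiples_add)
    qed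
    have n0: "n \<noteq> 0"
    proof
      assume "n = 0"
      then have "l = 0" using chart M by simp
      then show False using \<open>n = 0\<close> y by (simp add: n_def)
    qed
    \<comment> \<open>In the chart the line reads w = \<open>al\<close> z +
      \<open>be\<close>.\<close>
    define al be where ab: "al = - l / n" "be = 1 / n"
    have "al * (1 - M) = N" using chart n0 unfolding ab by (simp add: field_simps)
    then have "al = N * inverse (1 - M)" using M by (simp add: field_simps)
    then have al: "al \<in> multiples (z0^2)" using N M multiples_mult_right by blast
    have be_eq: "be = w1 - al * z1"
      using n0 y unfolding ab zw n_def by (simp add: field_simps)
    have alz: "al * u \<in> multiples (z0^3)" if "u \<in> multiples z0" for u
      using multiples_mult[OF al that] by (simp add: power2_eq_square power3_eq_cube mult.assoc)
    have be: "be \<in> multiples (z0^3)"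
      unfolding be_eq by (intro multiples_diff w alz z)
    have al3: "al \<in> multiples 3" "al \<in> R" using al z02 multiples_trans multiples3_R by blast+
    \<comment> \<open>The leading coefficient of the cubic in z obtained by inserting w =
      \<open>al\<close> z + \<open>be\<close> into the equation of the curve in the chart.\<close>
    define S where "S = A + B * al + C * al^2 + al^3"
    have "B * al + C * al^2 + al^3 \<in> multiples 3"
      unfolding power2_eq_square power3_eq_cube
      by (intro multiples_add multiples_mult_left al3 coeffs_R R_mult)
    then have "A + (B * al + C * al^2 + al^3) \<approx> 1 + 0"
      by (intro res_eq_add A_res) (simp add: res_eq_zero_iff)
    then have S: "S \<noteq> 0" "inverse S \<in> R" using res_eq_1_unit[of S] by (auto simp: S_def add.assoc)
    have v: "C - 2*l*n = A * (x1*x2 + x1*x3 + x2*x3)" "n^2 - 1 = A * (x1*x2*x3)"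
      using slope_vieta[OF on(1) 2(2,3) n_def] by auto
    have yn: "y1 = l * x1 + n" by (simp add: n_def)
    have yn2: "y2 = l * x2 + n"
      using 2(2) yn unfolding slope_def by algebra
    define y3 where "y3 = l * x3 + n"
    have nS: "n^3 * S = A * n^3 - B * n^2 * l + C * n * l^2 - l^3"
      using n0 unfolding S_def ab by (simp add: field_simps power2_eq_square power3_eq_cube)
    have yyy: "A * (y1 * y2 * y3) = n^3 * S"
      unfolding nS yn yn2 y3_def using v 2(3) by algebra
    then have y3: "y3 \<noteq> 0" using n0 S by auto
    define z3 where "z3 = x3 / y3"
    have "A * (x1*y2*y3 + x2*y1*y3 + x3*y1*y2) = - (3*l^2 - 2*l*n*C + n^2*B)"
      unfolding yn yn2 y3_def using v 2(3) by algebra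
    moreover have "z1 + z2 + z3 = A * (x1*y2*y3 + x2*y1*y3 + x3*y1*y2) / (A * (y1*y2*y3))"
      unfolding zw z3_def using y y3 A_nz by (simp add: field_simps)
    ultimately have "z1 + z2 + z3 = - (3*l^2 - 2*l*n*C + n^2*B) / (n^3 * S)"
      unfolding yyy by simp
    \<comment> \<open>This is the sum of the roots of that cubic. Its z^2-coefficient carries the
      factor \<open>be\<close>, which is of order three; the error term of the addition comes from
      here.\<close>
    also have "\<dots> = - ((3*al^2 + 2*al*C + B) * inverse S * be)"
      using n0 S unfolding ab by (simp add: field_simps power2_eq_square power3_eq_cube)
    finally have sum: "z1 + z2 + z3 \<in> multiples (z0^3)"
      using be S al3 coeffs_R
      by (auto intro!: multiples_uminus multiples_mult_left R_intros)
    have "z3 = (z1 + z2 + z3) - (z1 + z2)" by simp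
    then have z3: "z3 \<in> multiples z0"
      using multiples_diff multiples_add multiples_trans[OF sum z02(3)] z by metis
    have "al * z3 + be = (y3 - l * x3) / (n * y3)"
      using n0 y3 unfolding ab z3_def by (simp add: field_simps)
    also have "\<dots> = 1 / y3" using n0 by (simp add: y3_def)
    finally have "1 / y3 = al * z3 + be" ..
    then have w3: "1 / y3 \<in> multiples (z0^3)"
      using alz[OF z3] be multiples_add by simp
    have sum_eq: "add P Q = Pt x3 (- y3)"
      using 2(4) yn unfolding y3_def by (simp add: algebra_simps)
    have "add P Q \<in> pts" using points_add pts by simp
    then have "add P Q \<in> formal_nbhd z0"
      using multiples_uminus[OF z3] multiples_uminus[OF w3] y3 sum_eq
      by (simp add: formal_nbhd_def z3_def)
    moreover have "zcoord (add P Q) - (zcoord P + zcoord Q) = - (z1 + z2 + z3)"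
      unfolding sum_eq by (simp add: z3_def zw)
    then have "zcoord (add P Q) - (zcoord P + zcoord Q) \<in> multiples (z0^3)"
      using multiples_uminus[OF sum] by simp
    ultimately show ?thesis ..
  qed
qed (use P Q in \<open>auto simp: multiples_zero\<close>)

lemma formal_multiple:
  assumes z0: "z0 \<in> multiples 3" and P: "P \<in> formal_nbhd z0"
  shows "P [^]\<^bsub>E\<^esub> n \<in> formal_nbhd z0 \<and>
    zcoord (P [^]\<^bsub>E\<^esub> n) - of_nat n * zcoord P \<in> multiples (z0^3)"
proof (induction n)
  case 0
  then show ?case by (simp add: formal_nbhd_def multiples_zero)
next
  case (Suc n)
  let ?Q = "P [^]\<^bsub>E\<^esub> n"
  have "zcoord (add ?Q P) - of_nat (Suc n) * zcoord P =
      (zcoord (add ?Q P) - (zcoord ?Q + zcoord P)) + (zcoord ?Q - of_nat n * zcoord P)"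
    by (simp add: algebra_simps)
  also have "\<dots> \<in> multiples (z0^3)"
    using Suc formal_add[OF z0 _ P] by (intro multiples_add) auto
  finally show ?case using Suc formal_add[OF z0 _ P, of ?Q] by simp
qed

text \<open>With u = 1/x the equation becomes y^2 = x^3 e for a unit \<open>e\<close> congruent to
  1, so (x/y)^2 = u/e lies in the maximal ideal, and x/y follows by integral closedness and
  primality. Moreover 1/y = (x/y)^3 e, which is the cubic order of w.\<close>

lemma reduces_to_Infty_coords:
  assumes P: "Pt x y \<in> pts" and x: "x \<notin> R"
  shows "x / y \<in> multiples 3" "x / y \<noteq> 0" "Pt x y \<in> formal_nbhd (x / y)"
proof -
  have xK: "x \<in> K" and yK: "y \<in> K" and on: "y^2 = A*x^3 + B*x^2 + C*x + 1"
    using P by (auto simp: curve_Pt)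
  have x0: "x \<noteq> 0" using x R_zero by auto
  define u where "u = inverse x"
  have u: "u \<in> multiples 3" using inverse_in_multiples3 xK x by (simp add: u_def)
  then have uR: "u \<in> R" by (rule multiples3_R)
  define e where "e = A + (B * u + C * u^2 + u^3)"
  have "B * u + C * u^2 + u^3 \<in> multiples 3"
    unfolding power2_eq_square power3_eq_cube
    by (intro multiples_add multiples_mult_left u uR coeffs_R R_mult)
  then have "e \<approx> 1 + 0"
    unfolding e_def by (intro res_eq_add A_res) (simp add: res_eq_zero_iff)
  then have e: "e \<in> R" "e \<noteq> 0" "inverse e \<in> R" using res_eq_1_unit[of e] by auto
  have y2: "y^2 = x^3 * e"
    unfolding on e_def u_def using x0 by (simp add: field_simps power2_eq_square power3_eq_cube)
  then have y0: "y \<noteq> 0" using x0 e by auto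
  have z2: "(x / y)^2 = u * inverse e"
    using y2 x0 y0 e unfolding u_def power_divide by (simp add: field_simps power2_eq_square power3_eq_cube)
  then have "(x / y)^2 \<in> multiples 3" using u e multiples_mult_right by metis
  then show z3: "x / y \<in> multiples 3"
    using multiples3_power power_in_R[of "x / y" 2] multiples3_R K_divide xK yK by simp
  show "x / y \<noteq> 0" using x0 y0 by simp
  have "1 / y = (x / y)^3 * e"
    using y2 x0 y0 e unfolding power_divide by (simp add: field_simps power2_eq_square power3_eq_cube)
  then have "1 / y \<in> multiples ((x / y)^3)" using multiplesI e by metis
  then show "Pt x y \<in> formal_nbhd (x / y)"
    using P y0 multiples_self by (simp add: formal_nbhd_def)
qed

lemma formal_nbhd_reduces_to_Infty:
  assumes z0: "z0 \<in> multiples 3" and P: "P \<in> formal_nbhd z0"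
  shows "P \<in> reduces_to_Infty"
proof (cases P)
  case (Pt x y)
  then have pt: "Pt x y \<in> pts" and y: "y \<noteq> 0" and z: "x / y \<in> multiples z0" and w: "1 / y \<in> multiples (z0^3)"
    using P by (auto simp: formal_nbhd_def)
  have "x \<notin> R"
  proof
    assume x: "x \<in> R"
    have "z0^3 \<in> multiples 3"
      using z0 multiples3_R[OF z0] multiples_mult_right[OF z0] R_mult
      by (simp add: power3_eq_cube mult.assoc)
    then have "inverse y \<in> multiples 3" using w multiples_trans by (simp add: divide_inverse)
    then have "y \<notin> R" using notin_R_if_inverse y by blast
    moreover have "y^2 \<in> R"
      using pt x coeffs_R by (auto simp: curve_Pt intro!: R_intros)
    then have "y \<in> R" using power_in_R[of y 2] pt by auto
    ultimately show False by blast
  qed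
  then show ?thesis using pt Pt by (simp add: reduces_to_Infty_def)
qed (simp add: reduces_to_Infty_def)

lemma reduces_to_Infty_formal:
  assumes "P \<in> reduces_to_Infty" "P \<noteq> Infty"
  shows "zcoord P \<in> multiples 3" "zcoord P \<noteq> 0" "P \<in> formal_nbhd (zcoord P)"
proof -
  obtain x y where P: "P = Pt x y" using assms(2) by (cases P) auto
  then have "Pt x y \<in> pts" "x \<notin> R" using assms(1) by (auto simp: reduces_to_Infty_def)
  from reduces_to_Infty_coords[OF this]
  show "zcoord P \<in> multiples 3" "zcoord P \<noteq> 0" "P \<in> formal_nbhd (zcoord P)"
    unfolding P by simp_all
qed

lemma reduces_to_Infty_pow:
  assumes "P \<in> reduces_to_Infty"
  shows "P [^]\<^bsub>E\<^esub> (n::nat) \<in> reduces_to_Infty"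
proof (cases "P = Infty")
  case True
  then show ?thesis using assms E.nat_pow_one[of n] by simp
next
  case False
  then show ?thesis
    using reduces_to_Infty_formal[OF assms] formal_multiple formal_nbhd_reduces_to_Infty by blast
qed

text \<open>The neighbourhood is taken at the parameter z of \<open>P\<close> itself: nP = 0 gives
  that z^3 divides n z, and cancelling z leaves z^2, a multiple of 9, as a divisor of n.\<close>

lemma reduces_to_Infty_pow_nz:
  assumes P: "P \<in> reduces_to_Infty" "P \<noteq> Infty" and n: "\<not> 9 dvd n"
  shows "P [^]\<^bsub>E\<^esub> (n::nat) \<noteq> Infty"
proof
  assume eq: "P [^]\<^bsub>E\<^esub> n = Infty"
  let ?z = "zcoord P"
  note z = reduces_to_Infty_formal[OF P]
  have "zcoord (P [^]\<^bsub>E\<^esub> n) - of_nat n * ?z \<in> multiples (?z^3)"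
    using formal_multiple z by blast
  then have "of_nat n * ?z \<in> multiples (?z^3)"
    using eq multiples_uminus[of "- (of_nat n * ?z)"] by simp
  then have "?z * of_nat n \<in> multiples (?z * ?z^2)"
    by (simp add: mult.commute power2_eq_square power3_eq_cube)
  then have "of_nat n \<in> multiples (?z^2)" using multiples_cancel z by blast
  moreover have "?z^2 \<in> multiples 9" using multiples_power[OF z(1), of 2] by simp
  ultimately show False using of_nat_notin_multiples9[OF n] multiples_trans by blast
qed

text \<open>Descent: an exponent killing a nonzero point is divisible by 9, so 3P is killed by a
  smaller exponent and vanishes by induction. But 3 itself is not divisible by 9.\<close>

lemma reduces_to_Infty_torsion_free:
  assumes "P \<in> reduces_to_Infty" "n \<ge> 1" "P [^]\<^bsub>E\<^esub> (n::nat) = Infty"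
  shows "P = Infty"
  using assms
proof (induction n arbitrary: P rule: less_induct)
  case (less n)
  show ?case
  proof (rule ccontr)
    assume P: "P \<noteq> Infty"
    then have "9 dvd n" using reduces_to_Infty_pow_nz less.prems by blast
    then have "3 dvd n" by presburger
    then obtain m where m: "n = 3 * m" by (rule dvdE)
    have Pc: "P \<in> carrier E" using less.prems by (simp add: reduces_to_Infty_def)
    have "(P [^]\<^bsub>E\<^esub> (3::nat)) [^]\<^bsub>E\<^esub> m = Infty"
      using less.prems(3) Pc unfolding m by (simp add: E.nat_pow_pow)
    moreover have "m < n" "m \<ge> 1" using m less.prems(2) by auto
    ultimately have "P [^]\<^bsub>E\<^esub> (3::nat) = Infty"
      using less.IH reduces_to_Infty_pow less.prems(1) by blast
    then show False using reduces_to_Infty_pow_nz[of P 3] P less.prems(1) by simp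
  qed
qed

end

section \<open>Torsion of curves with supersingular reduction\<close>

context triple_curve_over
begin

lemma double_eq_Infty_iff: "add (Pt x y) (Pt x y) = Infty \<longleftrightarrow> y = 0"
  by (auto simp: ec_add_def Let_def)

lemma two_torsion:
  assumes "P \<in> ec_points K a b c" "add P P = Infty"
  shows "P \<in> {Infty, Pt (- 1 / a) 0, Pt (- 1 / b) 0, Pt (- 1 / c) 0}"
proof (cases P)
  case (Pt x y)
  then have y: "y = 0" using double_eq_Infty_iff assms by blast
  have "(a*x+1)*(b*x+1)*(c*x+1) = 0"
    using points_curve[OF assms(1)] Pt y by (simp add: on_curve_def)
  moreover have "x = - 1 / u" if "u*x + 1 = 0" "u \<noteq> 0" for u
    using that by (simp add: field_simps eq_neg_iff_add_eq_0)
  ultimately have "x = - 1 / a \<or> x = - 1 / b \<or> x = - 1 / c"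
    using a_nz b_nz c_nz by auto
  then show ?thesis using Pt y by auto
qed simp

lemma pow2: "P \<in> ec_points K a b c \<Longrightarrow> P [^]\<^bsub>E\<^esub> (2::nat) = add P P"
  by (simp add: numeral_2_eq_2)

lemma pow4:
  assumes "P \<in> ec_points K a b c"
  shows "P [^]\<^bsub>E\<^esub> (4::nat) = add (add P P) (add P P)"
  using E.nat_pow_pow[of P 2 2] assms pow2 points_add by simp

text \<open>The tangent at this point has slope \<open>p + q\<close> and meets the curve again in the
  2-torsion point.\<close>
lemma half_of_two_torsion:
  assumes p: "p^2 = c * (a - b)" and q: "q^2 = b * (a - c)" and K: "p \<in> K" "q \<in> K"
  defines "Q \<equiv> Pt ((p*q - b*c) / A) (p*q*(p+q) / A)"
  shows "Q \<in> ec_points K a b c" "add Q Q = Pt (- 1 / a) 0"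
proof -
  define x where "x = (p*q - b*c) / A"
  define y where "y = p*q*(p+q) / A"
  have x: "A * x = p*q - b*c" and y: "A * y = p*q*(p+q)"
    using A_nz by (simp_all add: x_def y_def)
  have ABC: "A = a*b*c" "B = a*b + a*c + b*c" "C = a + b + c"
    by (simp_all add: cubA_def cubB_def cubC_def)
  have "A^2 * y^2 = A^2 * (A*x^3 + B*x^2 + C*x + 1)"
    using x y p q unfolding ABC by algebra
  then have on: "curve (Pt x y)" unfolding curve_Pt using A_nz by simp
  then show "Q \<in> ec_points K a b c"
    unfolding Q_def using K a_in b_in c_in coeffs_in
    by (simp add: x_def y_def K_intros)
  have "p \<noteq> 0" "q \<noteq> 0" using p q b_nz c_nz a_neq_b a_neq_c by auto
  moreover have "p + q \<noteq> 0"
  proof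
    assume "p + q = 0"
    then have "a * (b - c) = 0" using p q by algebra
    then show False using a_nz b_neq_c by simp
  qed
  ultimately have y0: "y \<noteq> 0" using A_nz by (simp add: y_def)
  have "A * ((p + q) * (y + y)) = A * (A * (x^2 + x*x + x^2) + B * (x + x) + C)"
    using x y p q unfolding ABC by algebra
  then have sl: "slope x y x y (p + q)" unfolding slope_def using A_nz by simp
  have "add (Pt x y) (Pt x y) = Pt (- 1 / a) (- (y + (p + q) * (- 1 / a - x)))"
  proof (rule add_slope[OF on on _ sl])
    show "\<not> (x = x \<and> y = - y)" using y0 by simp
    have "A * (- 1 / a) = - b * c" using a_nz by (simp add: ABC)
    then show "A * (- 1 / a) = (p + q)^2 - B - A*x - A*x"
      using x p q unfolding ABC by algebra
  qed
  moreover have "- (y + (p + q) * (- 1 / a - x)) = 0"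
  proof -
    have "A * (- 1 / a) = - b * c" using a_nz by (simp add: ABC)
    then have "A * (- (y + (p + q) * (- 1 / a - x))) = 0" using x y by algebra
    then show ?thesis using A_nz by (simp del: minus_add_distrib)
  qed
  ultimately show "add Q Q = Pt (- 1 / a) 0"
    unfolding Q_def x_def[symmetric] y_def[symmetric] by simp
qed

text \<open>The addition sees \<open>a\<close>, \<open>b\<close>, \<open>c\<close> only through
  symmetric functions, so the halving of the 2-torsion point at -1/a can be reused for the one at
  -1/b.\<close>

lemma ec_add_swap12: "ec_add b a c = ec_add a b c"
proof -
  have "cubA b a c = A" "cubB b a c = B" "cubC b a c = C"
    by (simp_all add: cubA_def cubB_def cubC_def)
  then show ?thesis by (intro ext) (simp only: ec_add_def)
qed

lemma ec_points_swap12: "ec_points K b a c = ec_points K a b c"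
proof -
  have "on_curve b a c P = curve P" for P
    by (cases P) (simp_all add: on_curve_def mult.commute)
  then show ?thesis by (simp only: ec_points_def)
qed

text \<open>The elements \<open>p\<close>, \<open>q\<close> halve the 2-torsion point at -1/a, and
  \<open>r\<close>, \<open>s\<close> the one at -1/b. The third 2-torsion point is the sum of these
  two, so the halves generate the whole 4-torsion.\<close>

lemma torsion_group_iso:
  assumes K: "p \<in> K" "q \<in> K" "r \<in> K" "s \<in> K"
    and pq: "p^2 = c * (a - b)" "q^2 = b * (a - c)"
    and rs: "r^2 = c * (b - a)" "s^2 = a * (b - c)"
    and tors: "\<And>P. P \<in> ec_torsion K a b c \<Longrightarrow> P [^]\<^bsub>E\<^esub> (4::nat) = Infty"
  shows "ec_torsion_group K a b c \<cong> Z4xZ4"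
proof -
  obtain Q1 where Q1: "Q1 \<in> ec_points K a b c" "add Q1 Q1 = Pt (- 1 / a) 0"
    using half_of_two_torsion[OF pq K(1,2)] by blast
  interpret swap: triple_curve_over b a c K
    using a_nz b_nz c_nz a_neq_b a_neq_c b_neq_c a_in b_in c_in by unfold_locales auto
  obtain Q2 where Q2: "Q2 \<in> ec_points K a b c" "add Q2 Q2 = Pt (- 1 / b) 0"
    using swap.half_of_two_torsion[OF rs K(3,4)] ec_add_swap12 ec_points_swap12 by metis
  have int: "P [^]\<^bsub>E\<^esub> (numeral n :: int) = P [^]\<^bsub>E\<^esub> (numeral n :: nat)" for P n
    by (metis int_pow_int of_nat_numeral)
  note sq = int[of _ "num.Bit0 num.One"] pow2
  have zero: "add (Pt x 0) (Pt x 0) = Infty" for x by (simp add: ec_add_def)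
  have ne: "- 1 / a \<noteq> - 1 / b" "- 1 / a \<noteq> - 1 / c" "- 1 / b \<noteq> - 1 / c"
    using a_nz b_nz c_nz a_neq_b a_neq_c b_neq_c by (auto simp: field_simps)
  let ?T = "add (add Q1 Q1) (add Q2 Q2)"
  have pt: "add Q1 Q1 \<in> ec_points K a b c" "add Q2 Q2 \<in> ec_points K a b c"
    using points_add Q1(1) Q2(1) by blast+
  have T: "?T \<in> ec_points K a b c" using points_add pt by blast
  \<comment> \<open>The sum of two distinct nonzero 2-torsion points is 2-torsion, nonzero and
    different from both, so only one candidate is left.\<close>
  have "?T = Pt (- 1 / c) 0"
  proof -
    have "add ?T ?T = Infty"
    proof -
      have "?T [^]\<^bsub>E\<^esub> (2::int) = (add Q1 Q1) [^]\<^bsub>E\<^esub> (2::int) \<otimes>\<^bsub>E\<^esub> (add Q2 Q2) [^]\<^bsub>E\<^esub> (2::int)"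
        using E.int_pow_distrib[of "add Q1 Q1" "add Q2 Q2" 2] pt by simp
      then show ?thesis using sq T pt Q1 Q2 zero by simp
    qed
    then have mem: "?T \<in> {Infty, Pt (- 1 / a) 0, Pt (- 1 / b) 0, Pt (- 1 / c) 0}"
      using two_torsion T by blast
    have canc: "add X Y = X \<Longrightarrow> Y = Infty" if "X \<in> ec_points K a b c" "Y \<in> ec_points K a b c" for X Y
      using E.l_cancel_one[of X Y] that by simp
    have canc': "add X Y = Y \<Longrightarrow> X = Infty" if "X \<in> ec_points K a b c" "Y \<in> ec_points K a b c" for X Y
      using E.r_cancel_one[of Y X] that by simp
    have "?T \<noteq> Infty"
      using ne(1) unfolding Q1 Q2 by (simp add: ec_add_def Let_def)
    then show ?thesis
      using mem canc[OF pt] canc'[OF pt] Q1 Q2 by auto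
  qed
  then have two: "P \<in> {\<one>\<^bsub>E\<^esub>, Q1 [^]\<^bsub>E\<^esub> (2::int), Q2 [^]\<^bsub>E\<^esub> (2::int),
      Q1 [^]\<^bsub>E\<^esub> (2::int) \<otimes>\<^bsub>E\<^esub> Q2 [^]\<^bsub>E\<^esub> (2::int)}"
    if "P \<in> carrier E" "P [^]\<^bsub>E\<^esub> (2::int) = \<one>\<^bsub>E\<^esub>" for P
    using two_torsion[of P] that sq Q1 Q2 by auto
  have "Z4xZ4 \<cong> E\<lparr>carrier := {x \<in> carrier E. x [^]\<^bsub>E\<^esub> (4::int) = \<one>\<^bsub>E\<^esub>}\<rparr>"
    by (rule E.Z4xZ4_iso_4_torsion[OF _ _ _ _ _ _ _ two])
       (use Q1 Q2 int pow2 pow4 zero ne in auto)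
  moreover have "ec_torsion K a b c = {x \<in> carrier E. x [^]\<^bsub>E\<^esub> (4::int) = \<one>\<^bsub>E\<^esub>}"
  proof (intro subset_antisym subsetI)
    fix P assume "P \<in> ec_torsion K a b c"
    then show "P \<in> {x \<in> carrier E. x [^]\<^bsub>E\<^esub> (4::int) = \<one>\<^bsub>E\<^esub>}"
      using tors[of P] int by (auto simp: ec_torsion_eq)
  next
    fix P assume "P \<in> {x \<in> carrier E. x [^]\<^bsub>E\<^esub> (4::int) = \<one>\<^bsub>E\<^esub>}"
    then show "P \<in> ec_torsion K a b c"
      using int by (auto simp: ec_torsion_eq intro!: exI[of _ "4::nat"])
  qed
  then have "E\<lparr>carrier := {x \<in> carrier E. x [^]\<^bsub>E\<^esub> (4::int) = \<one>\<^bsub>E\<^esub>}\<rparr> = ec_torsion_group K a b c"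
    by (simp add: ec_group_def ec_torsion_group_def)
  ultimately show ?thesis using group.iso_sym[OF group_Z4xZ4] by metis
qed

text \<open>The tangent at (0,1) has slope C/2, so 2(0,1) has abscissa (C^2/4 - B)/A. It equals -1/a
  exactly if C^2 - 4B + 4bc = (a - b - c)^2 vanishes, and likewise for -1/b and -1/c; hence the
  three inequalities exclude 4(0,1) = 0.\<close>

lemma positive_rank:
  assumes ne: "a \<noteq> b + c" "b \<noteq> a + c" "c \<noteq> a + b"
    and tors: "\<And>P. P \<in> ec_torsion K a b c \<Longrightarrow> P [^]\<^bsub>E\<^esub> (4::nat) = Infty"
  shows "ec_positive_rank K a b c"
proof -
  have P: "Pt 0 1 \<in> ec_points K a b c" by (simp add: curve_Pt K_intros)
  have ABC: "A = a*b*c" "B = a*b + a*c + b*c" "C = a + b + c"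
    by (simp_all add: cubA_def cubB_def cubC_def)
  define x where "x = ((C / 2)^2 - B) / A"
  obtain y where d: "add (Pt 0 1) (Pt 0 1) = Pt x y"
    by (simp add: ec_add_def Let_def x_def)
  have dp: "Pt x y \<in> ec_points K a b c" using points_add[OF P P] d by simp
  have key: "add (Pt x y) (Pt x y) \<noteq> Infty"
  proof
    assume "add (Pt x y) (Pt x y) = Infty"
    then have x: "x = - 1 / a \<or> x = - 1 / b \<or> x = - 1 / c" using two_torsion dp by blast
    have Ax: "4 * (A * x) = C^2 - 4 * B" unfolding x_def using A_nz by (simp add: field_simps power2_eq_square)
    have "A * (- 1 / a) = - b * c" "A * (- 1 / b) = - a * c" "A * (- 1 / c) = - a * b"
      unfolding ABC using a_nz b_nz c_nz by (simp_all add: field_simps)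
    then have "A * x = - b * c \<or> A * x = - a * c \<or> A * x = - a * b"
      using x by metis
    then have "(a - (b + c))^2 = 0 \<or> (b - (a + c))^2 = 0 \<or> (c - (a + b))^2 = 0"
      using Ax unfolding ABC by algebra
    then show False using ne by simp
  qed
  have "Pt 0 1 [^]\<^bsub>E\<^esub> (4::nat) \<noteq> Infty" using pow4[OF P] key d by simp
  then have "Pt 0 1 \<notin> ec_torsion K a b c" using tors by blast
  then show ?thesis using P unfolding ec_positive_rank_def by blast
qed

end

section \<open>Quadrupling maps every point into the kernel of reduction\<close>

context supersingular_triple_curve
begin

text \<open>The reduced point is 2-torsion. If the double had integral abscissa, the slope would be
  integral, and the tangent equation would put \<open>C\<close> into the maximal ideal, whereas the
  derivative of x^3 + x + 1 is 1 in characteristic 3.\<close>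

lemma double_reduces_to_Infty:
  assumes P: "Pt x y \<in> pts" and x: "x \<in> R" and y: "y \<in> multiples 3"
  shows "add (Pt x y) (Pt x y) \<in> reduces_to_Infty"
proof -
  have on: "curve (Pt x y)" using P by simp
  have pt: "add (Pt x y) (Pt x y) \<in> pts" using points_add P by blast
  show ?thesis
  proof (cases rule: add_affine_cases[OF on on])
    case 1
    then show ?thesis by (simp add: reduces_to_Infty_def)
  next
    case (2 l x3)
    have "x3 \<notin> R"
    proof
      assume x3: "x3 \<in> R"
      have "l^2 = A * x3 + B + A*x + A*x" using 2(3) by (simp add: algebra_simps)
      also have "\<dots> \<in> R" by (intro R_intros coeffs_R x x3)
      finally have l2: "l^2 \<in> R" .
      have "l \<in> K"
      proof -
        have "y \<noteq> 0" using 2(1) by auto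
        then have "l = (A * (x^2 + x*x + x^2) + B * (x + x) + C) / (y + y)"
          using 2(2) unfolding slope_def by (simp add: field_simps)
        then show ?thesis using P coeffs_in by (simp add: K_intros)
      qed
      then have l: "l \<in> R" using power_in_R l2 by auto
      have "C = l * (y + y) - (3 * (A * x^2) + B * (x + x))"
        using 2(2) unfolding slope_def by algebra
      moreover have "B \<in> multiples 3" using B_res by (simp add: res_eq_zero_iff)
      then have "l * (y + y) - (3 * (A * x^2) + B * (x + x)) \<in> multiples 3"
        by (intro multiples_diff multiples_add multiples_mult_left[OF l]
            multiples_mult_right[OF multiples_self] multiples_mult_right y R_intros coeffs_R x)
      ultimately show False using res_eq_1_unit[OF C_res] by simp
    qed
    then show ?thesis using pt 2(4) by (simp add: reduces_to_Infty_def)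
  qed
qed

lemma res_eq_cube: "u \<in> R \<Longrightarrow> v \<in> R \<Longrightarrow> (u + v)^3 \<approx> u^3 + v^3"
  by (rule res_eq_3[of _ _ "u^2*v + u*v^2"])
     (auto simp: algebra_simps power2_eq_square power3_eq_cube intro!: R_intros)

lemma cubic_res: "x \<in> R \<Longrightarrow> A*x^3 + B*x^2 + C*x + 1 \<approx> x^3 + x + 1"
proof -
  assume x: "x \<in> R"
  have "A*x^3 + B*x^2 + C*x + 1 \<approx> 1*x^3 + 0*x^2 + 1*x + 1"
    by (intro res_eq_add res_eq_mult A_res B_res C_res res_eq_refl coeffs_R R_intros x)
  then show ?thesis by simp
qed

text \<open>Modulo 3, cubing sends x^3 + x + 1 to x^9 + x^3 + 1, which is the same value because x^9
  = x. So y^6 = y^2, and y^4 = 1 for a unit y.\<close>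

lemma unit_ordinate_res:
  assumes P: "Pt x y \<in> pts" and x: "x \<in> R" and y: "y \<in> R" "y \<notin> multiples 3"
  shows "y^2 \<approx> x^3 + x + 1" "y^4 \<approx> 1"
proof -
  show h: "y^2 \<approx> x^3 + x + 1"
    using cubic_res[OF x] P by (simp add: curve_Pt)
  have "x^9 \<approx> x"
    using res_eq_3[OF _ R_frobenius[OF x], of "x^9" x] by (simp add: field_simps)
  then have 9: "(x^3)^3 \<approx> x" by (simp flip: power_mult)
  have "(y^2)^3 \<approx> (x^3 + (x + 1))^3"
    using h by (intro res_eq_power) (auto intro: R_intros x simp: add.assoc)
  also have "(x^3 + (x + 1))^3 \<approx> (x^3)^3 + (x + 1)^3"
    by (intro res_eq_cube R_intros x)
  also have "(x^3)^3 + (x + 1)^3 \<approx> x + (x^3 + 1^3)"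
    by (intro res_eq_add 9 res_eq_cube R_intros x)
  also have "x + (x^3 + 1^3) = x^3 + x + 1" by simp
  also have "x^3 + x + 1 \<approx> y^2" using h by (rule res_eq_sym)
  finally have "(y^2)^3 - y^2 \<in> multiples 3" by (simp add: res_eq_def)
  moreover have "(y^2)^3 - y^2 = y^2 * (y^4 - 1)"
    by (simp add: algebra_simps flip: power_add power_mult)
  ultimately have "y^2 \<in> multiples 3 \<or> y^4 - 1 \<in> multiples 3"
    using multiples3_prime[of "y^2" "y^4 - 1"] y by (simp add: R_intros)
  then show "y^4 \<approx> 1"
    using multiples3_power y by (auto simp: res_eq_def)
qed

text \<open>Over the residue field the slope is l = 1/(2y) = -1/y, so (l y)^2 = 1, and the double
  has abscissa l^2 + x. Its squared ordinate is l^6 + l^2 + y^2, which vanishes once y^4 = 1 is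
  used: the double of such a point is 2-torsion after reduction.\<close>

lemma double_unit_ordinate:
  assumes P: "Pt x y \<in> pts" and x: "x \<in> R" and y: "y \<in> R" "y \<notin> multiples 3"
  obtains x3 y3 where "add (Pt x y) (Pt x y) = Pt x3 y3" "x3 \<in> R" "y3 \<in> multiples 3"
proof -
  have on: "curve (Pt x y)" using P by simp
  have pt: "add (Pt x y) (Pt x y) \<in> pts" using points_add P by blast
  show ?thesis
  proof (cases rule: add_affine_cases[OF on on])
    case 1
    then have "y = 0" by simp
    then show ?thesis using y multiples_zero by simp
  next
    case (2 l x3)
    have y0: "y \<noteq> 0" using 2(1) by auto
    have "y + y \<approx> - y" unfolding res_eq_def
      by (rule multiplesI[OF y(1)]) simp
    then have 2: "y + y \<notin> multiples 3"
      using res_eq_notin[of "y + y" "- y"] multiples_uminus[of "- y" 3] y by auto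
    then have yyi: "inverse (y + y) \<in> R" using unit_inverse y R_add by blast
    define y3 where "y3 = - (y + l * (x3 - x))"
    have num: "l * (y + y) = 3 * (A * x^2) + B * (x + x) + C"
      using \<open>slope x y x y l\<close> unfolding slope_def by algebra
    then have "l = (3 * (A * x^2) + B * (x + x) + C) * inverse (y + y)"
      using y0 by (simp add: field_simps)
    also have "\<dots> \<in> R" by (intro R_intros coeffs_R x yyi)
    finally have l: "l \<in> R" .
    have x3_eq: "A * x3 = l^2 - B - A*x - A*x" by fact
    then have "x3 = inverse A * (l^2 - B - A*x - A*x)" using A_nz by (simp add: field_simps)
    also have "\<dots> \<in> R" using res_eq_1_unit[OF A_res] by (intro R_intros coeffs_R x l) simp
    finally have x3: "x3 \<in> R" .
    have sum: "add (Pt x y) (Pt x y) = Pt x3 y3" using \<open>add (Pt x y) (Pt x y) = _\<close> by (simp add: y3_def)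
    have y3R: "y3 \<in> R" unfolding y3_def by (intro R_intros y l x3 x)
    have ly: "(l * y)^2 \<approx> 1"
    proof -
      have "3 * (A * x^2) \<in> multiples 3"
        by (intro multiples_mult_right[OF multiples_self] R_intros coeffs_R x)
      then have "3 * (A * x^2) + B * (x + x) + C \<approx> 0 + 0 * (x + x) + 1"
        by (intro res_eq_add res_eq_mult B_res C_res res_eq_refl coeffs_R R_intros x)
           (simp add: res_eq_zero_iff)
      then have "l * (y + y) \<approx> 1" using num by simp
      moreover have "3 * (l * y) \<in> multiples 3"
        by (intro multiples_mult_right[OF multiples_self] R_intros l y)
      ultimately have "l * (y + y) - 3 * (l * y) \<approx> 1 - 0"
        by (intro res_eq_diff) (simp_all add: res_eq_zero_iff)
      then have "(l * (y + y) - 3 * (l * y))^2 \<approx> (1 - 0)^2"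
        by (intro res_eq_power R_intros)
      moreover have "l * (y + y) - 3 * (l * y) = - (l * y)" by (simp add: algebra_simps)
      ultimately show ?thesis by simp
    qed
    have x3_res: "x3 \<approx> l^2 + x"
    proof -
      have "A * x3 \<approx> 1 * x3" by (intro res_eq_mult A_res res_eq_refl coeffs_R x3)
      then have "1 * x3 \<approx> A * x3" by (rule res_eq_sym)
      also have "A * x3 = l^2 - B - A*x - A*x" by fact
      also have "l^2 - B - A*x - A*x \<approx> l^2 - 0 - 1*x - 1*x"
        by (intro res_eq_diff res_eq_mult A_res B_res res_eq_refl coeffs_R R_intros x)
      also have "l^2 - 0 - 1*x - 1*x \<approx> l^2 + x"
        by (rule res_eq_3[of _ _ "- x"]) (auto intro: R_intros x)
      finally show ?thesis by simp
    qed
    have "y3^2 \<approx> x3^3 + x3 + 1"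
      using cubic_res[OF x3] pt sum by (simp add: curve_Pt)
    also have "x3^3 + x3 + 1 \<approx> (l^2 + x)^3 + (l^2 + x) + 1"
      by (intro res_eq_add res_eq_power x3_res res_eq_refl R_intros l x)
    also have "(l^2 + x)^3 + (l^2 + x) + 1 \<approx> ((l^2)^3 + x^3) + (l^2 + x) + 1"
      by (intro res_eq_add res_eq_cube res_eq_refl R_intros l x)
    also have "((l^2)^3 + x^3) + (l^2 + x) + 1 = (l^2)^3 + l^2 + (x^3 + x + 1)" by simp
    also have "(l^2)^3 + l^2 + (x^3 + x + 1) \<approx> (l^2)^3 + l^2 + y^2"
      by (intro res_eq_add res_eq_refl res_eq_sym[OF unit_ordinate_res(1)[OF P x y]])
    \<comment> \<open>Multiplication by the unit y^6 leaves an expression in (l y)^2 and y^4 alone,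
      both 1 modulo 3; the three terms add up to 3.\<close>
    finally have "(y^2)^3 * y3^2 \<approx> (y^2)^3 * ((l^2)^3 + l^2 + y^2)"
      by (intro res_eq_mult res_eq_refl R_intros y l)
    also have "(y^2)^3 * ((l^2)^3 + l^2 + y^2) = ((l*y)^2)^3 + (l*y)^2 * y^4 + (y^4)^2"
      by algebra
    also have "((l*y)^2)^3 + (l*y)^2 * y^4 + (y^4)^2 \<approx> 1^3 + 1 * 1 + 1^2"
      by (intro res_eq_add res_eq_power res_eq_mult ly unit_ordinate_res(2)[OF P x y] R_intros l y)
    also have "1^3 + 1 * 1 + 1^2 \<approx> (0::'a)"
      by (rule res_eq_3[of _ _ 1]) (auto intro: R_one)
    finally have "(y^2)^3 * y3^2 \<in> multiples 3" by (simp add: res_eq_zero_iff)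
    then have "(y^2)^3 \<in> multiples 3 \<or> y3^2 \<in> multiples 3"
      using multiples3_prime y y3R R_power by blast
    then have "y3 \<in> multiples 3"
      using multiples3_power y y3R R_power by blast
    then show ?thesis using that sum x3 by blast
  qed
qed

lemma pow4_reduces_to_Infty:
  assumes P: "P \<in> pts"
  shows "P [^]\<^bsub>E\<^esub> (4::nat) \<in> reduces_to_Infty"
proof (cases "P \<in> reduces_to_Infty")
  case True
  then show ?thesis by (rule reduces_to_Infty_pow)
next
  case False
  then obtain x y where Pt: "P = Pt x y" and x: "x \<in> R" using P by (cases P) (auto simp: reduces_to_Infty_def)
  have pt: "Pt x y \<in> pts" using P Pt by simp
  have "y^2 \<in> R"
    using pt x coeffs_R by (auto simp: curve_Pt intro!: R_intros)
  then have y: "y \<in> R" using power_in_R[of y 2] pt by auto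
  have dbl: "add P P \<in> pts" using points_add P by blast
  show ?thesis
  proof (cases "y \<in> multiples 3")
    case True
    then have "add P P \<in> reduces_to_Infty" using double_reduces_to_Infty pt x Pt by blast
    then show ?thesis
      using reduces_to_Infty_pow[of "add P P" 2] pow4[OF P] pow2[OF dbl] by simp
  next
    case False
    then obtain x3 y3 where 3: "add P P = Pt x3 y3" "x3 \<in> R" "y3 \<in> multiples 3"
      using double_unit_ordinate[OF pt x y] Pt by metis
    then show ?thesis using double_reduces_to_Infty dbl pow4[OF P] by simp
  qed
qed

lemma torsion_pow4:
  assumes "P \<in> ec_torsion K a b c"
  shows "P [^]\<^bsub>E\<^esub> (4::nat) = Infty"
proof -
  obtain n :: nat where P: "P \<in> pts" and n: "n \<ge> 1" "P [^]\<^bsub>E\<^esub> n = Infty"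
    using assms by (auto simp: ec_torsion_eq)
  have "(P [^]\<^bsub>E\<^esub> (4::nat)) [^]\<^bsub>E\<^esub> n = (P [^]\<^bsub>E\<^esub> n) [^]\<^bsub>E\<^esub> (4::nat)"
    using P by (simp add: E.nat_pow_pow mult.commute)
  also have "\<dots> = Infty" using n E.nat_pow_one[of 4] by simp
  finally show ?thesis
    using reduces_to_Infty_torsion_free pow4_reduces_to_Infty P n by blast
qed

end

section \<open>A one-parameter family of triples\<close>

definition fam_u :: "'a::field_char_0 \<Rightarrow> 'a" where "fam_u t = 1 + 2 * t"
definition fam_p :: "'a::field_char_0 \<Rightarrow> 'a" where "fam_p t = 1 - t^2"
definition fam_q :: "'a::field_char_0 \<Rightarrow> 'a" where "fam_q t = 1 + t + t^2"

text \<open>Since bc = -1, the product (ab)(ac) is -a^2, so a is a square root of -(r^2 - 1)(s^2 -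
  1) when ab + 1 = r^2 and ac + 1 = s^2. For r = (u - p)/(u + p) and s = r (u^2 - p^2)/(u^2 + p^2),
  the product (r^2 - 1)(s^2 - 1) is a square times u^2 - up + p^2, which is where the conic comes
  from.\<close>

definition fam_a :: "'a::field_char_0 \<Rightarrow> 'a \<Rightarrow> 'a" where
  "fam_a j t = - 4 * j * fam_p t * fam_q t * fam_u t /
     ((fam_u t + fam_p t) * (fam_u t ^ 2 + fam_p t ^ 2))"

definition fam_b :: "'a::field_char_0 \<Rightarrow> 'a \<Rightarrow> 'a" where
  "fam_b j t = - j * (fam_u t ^ 2 + fam_p t ^ 2) / ((fam_u t + fam_p t) * fam_q t)"

definition fam_c :: "'a::field_char_0 \<Rightarrow> 'a \<Rightarrow> 'a" where
  "fam_c j t = - j * ((fam_u t + fam_p t) * fam_q t) / (fam_u t ^ 2 + fam_p t ^ 2)"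

lemma fam_conic: "fam_q t ^ 2 = fam_u t ^ 2 - fam_u t * fam_p t + fam_p t ^ 2"
  unfolding fam_u_def fam_p_def fam_q_def by algebra

text \<open>The conic enters through n^2 - (u - p)^4 = 4 p u (u^2 - up + p^2), which gives s. The
  last square is r^2 - s^2, and it is one by (u^2 + p^2)^2 - (u^2 - p^2)^2 = (2up)^2.\<close>

lemma fam_squares:
  fixes j t :: "'a::field_char_0"
  assumes j: "j^2 = - 1"
    and nz: "fam_u t + fam_p t \<noteq> 0" "fam_u t ^ 2 + fam_p t ^ 2 \<noteq> 0" "fam_q t \<noteq> 0"
  defines "a \<equiv> fam_a j t" and "b \<equiv> fam_b j t" and "c \<equiv> fam_c j t"
    and "r \<equiv> (fam_u t - fam_p t) / (fam_u t + fam_p t)"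
    and "s \<equiv> (fam_u t - fam_p t)^2 / (fam_u t ^ 2 + fam_p t ^ 2)"
    and "w \<equiv> 2 * ((fam_u t - fam_p t) / (fam_u t + fam_p t)) * (fam_p t * fam_u t) /
      (fam_u t ^ 2 + fam_p t ^ 2)"
  shows "b * c = - 1" "a * b + 1 = r^2" "a * c + 1 = s^2" "a * (b - c) = w^2"
proof -
  define u p q where upq: "u = fam_u t" "p = fam_p t" "q = fam_q t"
  define m n where mn: "m = u + p" "n = u^2 + p^2"
  have m: "m \<noteq> 0" and n: "n \<noteq> 0" and q: "q \<noteq> 0" using nz by (simp_all add: mn upq)
  have a: "a = - 4 * j * p * q * u / (m * n)" and b: "b = - j * n / (m * q)"
    and c: "c = - j * (m * q) / n"
    by (simp_all add: a_def b_def c_def fam_a_def fam_b_def fam_c_def mn upq)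
  have r: "r = (u - p) / m" and s: "s = (u - p)^2 / n" and w: "w = 2 * ((u - p) / m) * (p * u) / n"
    by (simp_all add: r_def s_def w_def mn upq)
  have jj: "j * (j * x) = - x" for x
    using j by (metis mult.assoc mult_minus1 power2_eq_square)
  show "b * c = - 1" unfolding b c using m n q j by (simp add: power2_eq_square)
  have ab: "a * b = - 4 * p * u / m^2"
    unfolding a b using m n q by (simp add: jj power2_eq_square field_simps)
  have "m^2 - 4 * p * u = (u - p)^2" unfolding mn by algebra
  then have "(m^2 - 4 * p * u) / m^2 = r^2" unfolding r by (simp add: power_divide)
  then show r2: "a * b + 1 = r^2"
    unfolding ab using m by (simp add: diff_divide_distrib)
  have ac: "a * c = - 4 * p * u * q^2 / n^2"
    unfolding a c using m n q by (simp add: jj power2_eq_square field_simps)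
  have "n^2 - 4 * p * u * q^2 = ((u - p)^2)^2"
    using fam_conic[of t] unfolding upq[symmetric] mn by algebra
  then have "(n^2 - 4 * p * u * q^2) / n^2 = s^2" unfolding s by (simp add: power_divide)
  then show s2: "a * c + 1 = s^2"
    unfolding ac using n by (simp add: diff_divide_distrib)
  have "a * (b - c) = r^2 - s^2" using r2 s2 by algebra
  also have "\<dots> = ((u - p)^2 * (n^2 - m^2 * (u - p)^2)) / (m^2 * n^2)"
    unfolding r s using m n by (simp add: field_simps power2_eq_square)
  also have "n^2 - m^2 * (u - p)^2 = 4 * (p * u)^2" unfolding mn by algebra
  also have "((u - p)^2 * (4 * (p * u)^2)) / (m^2 * n^2) = w^2"
    unfolding w by (simp add: power_divide power_mult_distrib del: right_diff_distrib_numeral)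
  finally show "a * (b - c) = w^2" .
qed

section \<open>Residues of the family for \<open>t\<close> close to \<open>j\<close>\<close>

locale place9_i = place9 K R
  for K :: "'a::field_char_0 set" and R +
  fixes j :: 'a
  assumes j_R: "j \<in> R" and j2: "j^2 = - 1"
begin

text \<open>Units are certified by explicit inverses modulo 3: (1 + j)(j - 1) = (1 - j)(-1 - j) =
  -2, which is congruent to 1, and j(-j) = 1.\<close>

lemma unit_if_mult_unit:
  assumes "y \<in> R" "x * y \<approx> 1"
  shows "x \<notin> multiples 3"
  using multiples_mult_right[of x 3 y] assms res_eq_1_unit by blast

lemma res_eq_divide:
  assumes "x \<approx> r * y" "y \<in> R" "y \<notin> multiples 3" "r \<in> R"
  shows "x / y \<approx> r"
proof -
  have "inverse y * (x - r * y) \<in> multiples 3"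
    using assms unit_inverse by (intro multiples_mult_left) (simp_all add: res_eq_def)
  moreover have "inverse y * (x - r * y) = x / y - r"
    using unit_nz[OF assms(3)] by (simp add: field_simps)
  ultimately show ?thesis by (simp add: res_eq_def)
qed

lemma unit_1pj: "1 + j \<notin> multiples 3"
  by (rule unit_if_mult_unit[of "j - 1"], intro R_intros j_R)
     (rule res_eq_3[of _ _ "- 1"], use j2 in algebra, intro R_intros)

lemma unit_1mj: "1 - j \<notin> multiples 3"
  by (rule unit_if_mult_unit[of "- 1 - j"], intro R_intros j_R)
     (rule res_eq_3[of _ _ "- 1"], use j2 in algebra, intro R_intros)

lemma unit_j: "j \<notin> multiples 3"
  by (rule unit_if_mult_unit[of "- j"], intro R_intros j_R)
     (rule res_eq_3[of _ _ "0"], use j2 in algebra, intro R_intros)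

lemma unit_1: "1 \<notin> multiples 3"
  by (rule one_notin_multiples3)

lemma unit_uminus: "- x \<notin> multiples 3" if "x \<notin> multiples 3"
  using multiples_uminus[of "- x" 3] that by auto

lemma neq_if_diff_unit: "x - y \<approx> z \<Longrightarrow> z \<notin> multiples 3 \<Longrightarrow> x \<noteq> y"
  using res_eq_notin[of "x - y" z] multiples_zero by auto

context
  fixes t :: 'a
  assumes t: "t - j \<in> multiples 9"
begin

lemma nine_dvd_three: "multiples 9 \<subseteq> multiples 3"
  using multiples_trans multiplesI[of 3 9 3] R_numeral[of "num.Bit1 num.One"] by auto

lemma t_res: "t \<approx> j"
  using t nine_dvd_three by (auto simp: res_eq_def)

lemma t_R: "t \<in> R"
  using t_res res_eq_R j_R by blast

lemma fam_R: "fam_u t \<in> R" "fam_p t \<in> R" "fam_q t \<in> R"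
  unfolding fam_u_def fam_p_def fam_q_def by (intro R_intros t_R)+

lemma fam_u_res: "fam_u t \<approx> 1 - j"
proof -
  have "fam_u t \<approx> 1 + 2 * j"
    unfolding fam_u_def by (intro res_eq_add res_eq_mult res_eq_refl t_res R_intros j_R)
  also have "1 + 2 * j \<approx> 1 - j" by (rule res_eq_3[of _ _ j]) (auto intro: j_R)
  finally show ?thesis .
qed

lemma fam_p_res: "fam_p t \<approx> - 1"
proof -
  have "fam_p t \<approx> 1 - j^2"
    unfolding fam_p_def by (intro res_eq_diff res_eq_power res_eq_refl t_res j_R)
  also have "1 - j^2 \<approx> - 1" by (rule res_eq_3[of _ _ 1]) (auto simp: j2 intro: R_one)
  finally show ?thesis .
qed

lemma fam_q_res: "fam_q t \<approx> j"
proof -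
  have "fam_q t \<approx> 1 + j + j^2"
    unfolding fam_q_def by (intro res_eq_add res_eq_power res_eq_refl t_res j_R)
  then show ?thesis by (simp add: j2)
qed

lemma fam_m_res: "fam_u t + fam_p t \<approx> - j"
  using res_eq_add[OF fam_u_res fam_p_res] by simp

lemma fam_n_res: "fam_u t ^ 2 + fam_p t ^ 2 \<approx> 1 + j"
proof -
  have "fam_u t ^ 2 + fam_p t ^ 2 \<approx> (1 - j)^2 + (- 1)^2"
    by (intro res_eq_add res_eq_power fam_u_res fam_p_res R_intros j_R)
  also have "(1 - j)^2 + (- 1)^2 \<approx> 1 + j"
    by (rule res_eq_3[of _ _ "- j"], use j2 in algebra, intro R_intros j_R)
  finally show ?thesis .
qed

lemma fam_units:
  "fam_u t + fam_p t \<notin> multiples 3" "fam_u t ^ 2 + fam_p t ^ 2 \<notin> multiples 3"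
  "fam_q t \<notin> multiples 3"
  using res_eq_notin[OF fam_m_res] res_eq_notin[OF fam_n_res] res_eq_notin[OF fam_q_res]
    unit_uminus unit_j unit_1pj by auto

text \<open>The residues -1, 1 - j, 1 + j of the triple are the values of -1/x at the roots 1, 1 +
  j, 1 - j of x^3 + x + 1 in the field with nine elements.\<close>

lemma fam_a_res: "fam_a j t \<approx> - 1"
  unfolding fam_a_def
proof (rule res_eq_divide)
  have "- 4 * j * fam_p t * fam_q t * fam_u t \<approx> - 4 * j * (- 1) * j * (1 - j)"
    by (intro res_eq_mult res_eq_refl fam_p_res fam_q_res fam_u_res R_intros j_R fam_R)
  also have "- 4 * j * (- 1) * j * (1 - j) \<approx> - 1 * (- j * (1 + j))"
    by (rule res_eq_3[of _ _ "j - 1"], use j2 in algebra, intro R_intros j_R)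
  also have "- 1 * (- j * (1 + j)) \<approx> - 1 * ((fam_u t + fam_p t) * (fam_u t ^ 2 + fam_p t ^ 2))"
    by (rule res_eq_sym)
       (intro res_eq_mult res_eq_refl fam_m_res fam_n_res R_intros j_R fam_R)
  finally show "- 4 * j * fam_p t * fam_q t * fam_u t \<approx>
      - 1 * ((fam_u t + fam_p t) * (fam_u t ^ 2 + fam_p t ^ 2))" .
qed (use multiples3_prime[of "fam_u t + fam_p t" "fam_u t ^ 2 + fam_p t ^ 2"] fam_units fam_R
  in \<open>auto intro!: R_intros\<close>)

lemma fam_b_res: "fam_b j t \<approx> 1 - j"
  unfolding fam_b_def
proof (rule res_eq_divide)
  have "- j * (fam_u t ^ 2 + fam_p t ^ 2) \<approx> - j * (1 + j)"
    by (intro res_eq_mult res_eq_refl fam_n_res R_intros j_R)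
  also have "- j * (1 + j) = (1 - j) * (- j * j)"
    using j2 by algebra
  also have "(1 - j) * (- j * j) \<approx> (1 - j) * ((fam_u t + fam_p t) * fam_q t)"
    by (rule res_eq_sym)
       (intro res_eq_mult res_eq_refl fam_m_res fam_q_res R_intros j_R fam_R)
  finally show "- j * (fam_u t ^ 2 + fam_p t ^ 2) \<approx> (1 - j) * ((fam_u t + fam_p t) * fam_q t)" .
qed (use multiples3_prime[of "fam_u t + fam_p t" "fam_q t"] fam_units fam_R j_R
  in \<open>auto intro!: R_intros\<close>)

lemma fam_c_res: "fam_c j t \<approx> 1 + j"
  unfolding fam_c_def
proof (rule res_eq_divide)
  have "- j * ((fam_u t + fam_p t) * fam_q t) \<approx> - j * (- j * j)"
    by (intro res_eq_mult res_eq_refl fam_m_res fam_q_res R_intros j_R fam_R)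
  also have "- j * (- j * j) \<approx> (1 + j) * (1 + j)"
    by (rule res_eq_3[of _ _ "- j"], use j2 in algebra, intro R_intros j_R)
  also have "(1 + j) * (1 + j) \<approx> (1 + j) * (fam_u t ^ 2 + fam_p t ^ 2)"
    by (rule res_eq_sym) (intro res_eq_mult res_eq_refl fam_n_res R_intros j_R fam_R)
  finally show "- j * ((fam_u t + fam_p t) * fam_q t) \<approx> (1 + j) * (fam_u t ^ 2 + fam_p t ^ 2)" .
qed (use fam_units fam_R j_R in \<open>auto intro!: R_intros\<close>)

lemma fam_abc_R: "fam_a j t \<in> R" "fam_b j t \<in> R" "fam_c j t \<in> R"
  by (rule res_eq_R[OF fam_a_res] res_eq_R[OF fam_b_res] res_eq_R[OF fam_c_res], intro R_intros j_R)+

lemma fam_nz: "fam_a j t \<noteq> 0" "fam_b j t \<noteq> 0" "fam_c j t \<noteq> 0"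
  using res_eq_notin[OF fam_a_res] res_eq_notin[OF fam_b_res] res_eq_notin[OF fam_c_res]
    unit_uminus[OF unit_1] unit_1mj unit_1pj unit_nz by auto

lemma fam_distinct: "fam_a j t \<noteq> fam_b j t" "fam_a j t \<noteq> fam_c j t" "fam_b j t \<noteq> fam_c j t"
proof -
  have "- 1 - (1 - j) \<approx> 1 + j" "- 1 - (1 + j) \<approx> 1 - j" "1 - j - (1 + j) \<approx> j"
    by (rule res_eq_3[of _ _ "- 1"], algebra, intro R_intros)
       (rule res_eq_3[of _ _ "- 1"], algebra, intro R_intros,
        rule res_eq_3[of _ _ "- j"], algebra, intro R_intros j_R)
  then show "fam_a j t \<noteq> fam_b j t" "fam_a j t \<noteq> fam_c j t" "fam_b j t \<noteq> fam_c j t"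
    using res_eq_diff fam_a_res fam_b_res fam_c_res unit_1mj unit_1pj unit_j
      neq_if_diff_unit res_eq_trans by meson+
qed

lemma fam_supersingular: "supersingular_triple_curve (fam_a j t) (fam_b j t) (fam_c j t) K R"
proof unfold_locales
  let ?a = "fam_a j t" and ?b = "fam_b j t" and ?c = "fam_c j t"
  show "?a \<noteq> 0" "?b \<noteq> 0" "?c \<noteq> 0" "?a \<noteq> ?b" "?a \<noteq> ?c" "?b \<noteq> ?c"
    using fam_nz fam_distinct by auto
  show "?a \<in> K" "?b \<in> K" "?c \<in> K" using fam_abc_R R_sub by auto
  have "cubA ?a ?b ?c \<approx> - 1 * (1 - j) * (1 + j)"
    unfolding cubA_def by (intro res_eq_mult fam_a_res fam_b_res fam_c_res fam_abc_R R_intros j_R)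
  also have "- 1 * (1 - j) * (1 + j) \<approx> 1"
    by (rule res_eq_3[of _ _ "- 1"], use j2 in algebra, intro R_intros)
  finally show "cubA ?a ?b ?c \<approx> 1" .
  have "cubB ?a ?b ?c \<approx> - 1 * (1 - j) + - 1 * (1 + j) + (1 - j) * (1 + j)"
    unfolding cubB_def
    by (intro res_eq_add res_eq_mult fam_a_res fam_b_res fam_c_res fam_abc_R R_intros j_R)
  also have "- 1 * (1 - j) + - 1 * (1 + j) + (1 - j) * (1 + j) = 0"
    using j2 by algebra
  finally show "cubB ?a ?b ?c \<approx> 0" .
  have "cubC ?a ?b ?c \<approx> - 1 + (1 - j) + (1 + j)"
    unfolding cubC_def by (intro res_eq_add fam_a_res fam_b_res fam_c_res)
  then show "cubC ?a ?b ?c \<approx> 1" by simp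
qed

text \<open>Modulo 3 the two sides agree, so residues do not decide. Cleared of denominators, and
  with m^2 - 4pu = (u - p)^2, equality means n^2 + (u - p)^2 q^2 = 0, which splits by means of
  \<open>j\<close>. One factor is a unit; the other takes the value 6j at t = j, so it is nonzero
  modulo 9.\<close>

lemma fam_a_neq_b_plus_c: "fam_a j t \<noteq> fam_b j t + fam_c j t"
proof
  define u p q where upq: "u = fam_u t" "p = fam_p t" "q = fam_q t"
  define m n where mn: "m = u + p" "n = u^2 + p^2"
  assume "fam_a j t = fam_b j t + fam_c j t"
  then have eq: "- 4 * j * p * q * u / (m * n) = - j * n / (m * q) + - j * (m * q) / n"
    by (simp add: fam_a_def fam_b_def fam_c_def upq mn)
  have nz: "m \<noteq> 0" "n \<noteq> 0" "q \<noteq> 0" "j \<noteq> 0"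
    using fam_units unit_j unit_nz by (auto simp: upq mn)
  have "- j * (4 * p * q^2 * u) = (- 4 * j * p * q * u / (m * n)) * (m * n * q)"
    using nz by (simp add: power2_eq_square)
  also have "\<dots> = - j * (n^2 + m^2 * q^2)"
    unfolding eq using nz by (simp add: field_simps power2_eq_square)
  finally have "4 * p * q^2 * u = n^2 + m^2 * q^2" using nz by simp
  then have "(n - j * (u - p) * q) * (n + j * (u - p) * q) = 0"
    using j2 unfolding mn by algebra
  moreover have "n + j * (u - p) * q \<noteq> 0"
  proof -
    have "n + j * (u - p) * q \<approx> (1 + j) + j * ((1 - j) - (- 1)) * j"
      unfolding mn upq
      by (intro res_eq_add res_eq_mult res_eq_diff res_eq_refl fam_n_res fam_u_res fam_p_res fam_q_res
          R_intros j_R fam_R)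
    also have "(1 + j) + j * ((1 - j) - (- 1)) * j = - (1 - 2 * j)"
      using j2 by algebra
    also have "- (1 - 2 * j) \<approx> - (1 + j)"
      by (rule res_eq_3[of _ _ j], algebra, intro j_R)
    finally show ?thesis using res_eq_notin unit_uminus[OF unit_1pj] unit_nz by blast
  qed
  moreover have "n - j * (u - p) * q \<noteq> 0"
  proof
    assume 0: "n - j * (u - p) * q = 0"
    \<comment> \<open>The divided difference between \<open>t\<close> and \<open>j\<close> of n - j
      (u - p) q, a quartic in t.\<close>
    define Q where "Q = (4 - 2*j) + (2 - 3*j) * (t + j) - 3 * j * (t^2 + t*j + j^2) +
      (1 - j) * (t^3 + t^2*j + t*j^2 + j^3)"
    have "n - j * (u - p) * q = 6 * j + (t - j) * Q"
      unfolding mn upq fam_u_def fam_p_def fam_q_def Q_def using j2 by algebra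
    moreover have "(t - j) * Q \<in> multiples 9"
      by (intro multiples_mult_right t) (unfold Q_def, intro R_intros j_R t_R)
    ultimately have "6 * j \<in> multiples 9"
      using 0 multiples_uminus by (metis add_eq_0_iff2)
    then have "3 * (2 * j) \<in> multiples (3 * 3)" by simp
    then have "2 * j \<in> multiples 3" by (rule multiples_cancel[rotated]) simp
    moreover have "2 * j \<approx> - j" by (rule res_eq_3[of _ _ j]) (auto intro: j_R)
    ultimately show False using res_eq_notin unit_uminus[OF unit_j] by blast
  qed
  ultimately show False by simp
qed

lemma fam_other_sums: "fam_b j t \<noteq> fam_a j t + fam_c j t" "fam_c j t \<noteq> fam_a j t + fam_b j t"
proof -
  have "1 - j - (- 1 + (1 + j)) \<approx> 1 + j"
    by (rule res_eq_3[of _ _ "- j"], algebra, intro R_intros j_R)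
  then show "fam_b j t \<noteq> fam_a j t + fam_c j t"
    using res_eq_diff[OF fam_b_res res_eq_add[OF fam_a_res fam_c_res]] unit_1pj
      neq_if_diff_unit res_eq_trans by blast
  have "1 + j - (- 1 + (1 - j)) \<approx> 1 - j"
    by (rule res_eq_3[of _ _ "j"], algebra, intro R_intros j_R)
  then show "fam_c j t \<noteq> fam_a j t + fam_b j t"
    using res_eq_diff[OF fam_c_res res_eq_add[OF fam_a_res fam_b_res]] unit_1mj
      neq_if_diff_unit res_eq_trans by blast
qed

theorem family:
  "diophantine_triple K (fam_a j t) (fam_b j t) (fam_c j t)"
  "ec_torsion_group K (fam_a j t) (fam_b j t) (fam_c j t) \<cong> Z4xZ4"
  "ec_positive_rank K (fam_a j t) (fam_b j t) (fam_c j t)"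
proof -
  let ?a = "fam_a j t" and ?b = "fam_b j t" and ?c = "fam_c j t"
  interpret supersingular_triple_curve ?a ?b ?c K R by (rule fam_supersingular)
  define r where "r = (fam_u t - fam_p t) / (fam_u t + fam_p t)"
  define s where "s = (fam_u t - fam_p t)^2 / (fam_u t ^ 2 + fam_p t ^ 2)"
  define w where "w = 2 * ((fam_u t - fam_p t) / (fam_u t + fam_p t)) * (fam_p t * fam_u t) /
      (fam_u t ^ 2 + fam_p t ^ 2)"
  have K: "r \<in> K" "s \<in> K" "w \<in> K" "j \<in> K"
    unfolding r_def s_def w_def using fam_R j_R R_sub by (auto intro!: K_intros)
  have sq: "?b * ?c = - 1" "?a * ?b + 1 = r^2" "?a * ?c + 1 = s^2" "?a * (?b - ?c) = w^2"
    using fam_squares[OF j2, of t] fam_units unit_nz unfolding r_def s_def w_def by blast+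
  have "?b * ?c + 1 = 0^2" using sq by simp
  then show "diophantine_triple K ?a ?b ?c"
    using sq K K_zero a_in b_in c_in fam_nz fam_distinct
    unfolding diophantine_triple_def is_square_in_def by metis
  show "ec_torsion_group K ?a ?b ?c \<cong> Z4xZ4"
  proof (rule torsion_group_iso)
    show "s \<in> K" "r \<in> K" "j * s \<in> K" "w \<in> K" using K K_mult by auto
    \<comment> \<open>From bc = -1 come c(a - b) = ac + 1 and b(a - c) = ab + 1. The opposite sign
      in c(b - a) is absorbed by \<open>j\<close>, the square root of -1.\<close>
    show "s^2 = ?c * (?a - ?b)" "r^2 = ?b * (?a - ?c)" "(j * s)^2 = ?c * (?b - ?a)"
      using sq j2 by algebra+
    show "w^2 = ?a * (?b - ?c)" using sq by simp
  qed (rule torsion_pow4)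
  show "ec_positive_rank K ?a ?b ?c"
    using positive_rank[OF fam_a_neq_b_plus_c fam_other_sums torsion_pow4] .
qed

end

end

section \<open>The field of Gaussian rationals\<close>

definition Z_loc3 :: "real set" where
  "Z_loc3 = {of_int m / of_int d |m d. \<not> 3 dvd d}"

text \<open>The localisation of Z[i] at 3. Integrality is tested on both coordinates, as 1 and i
  stay a basis after localisation.\<close>

definition Zi_loc3 :: "complex set" where
  "Zi_loc3 = {x. Re x \<in> Z_loc3 \<and> Im x \<in> Z_loc3}"

lemma Z_loc3I: "\<not> 3 dvd d \<Longrightarrow> x = of_int m / of_int d \<Longrightarrow> x \<in> Z_loc3"
  unfolding Z_loc3_def by blast

lemma Z_loc3E:
  assumes "x \<in> Z_loc3"
  obtains m d where "\<not> 3 dvd d" "d \<noteq> 0" "x = of_int m / of_int d"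
proof -
  obtain m d where md: "\<not> 3 dvd d" "x = of_int m / of_int d"
    using assms unfolding Z_loc3_def by blast
  then have "d \<noteq> 0" by auto
  with md that show ?thesis by blast
qed

lemma not_3_dvd_mult: "\<not> 3 dvd d \<Longrightarrow> \<not> 3 dvd e \<Longrightarrow> \<not> 3 dvd d * e" for d e :: int
  using prime_dvd_mult_iff[of "3::int"] by simp

lemma Z_loc3_of_int: "of_int m \<in> Z_loc3"
  by (rule Z_loc3I[of 1 _ m]) auto

lemma Z_loc3_add: "x \<in> Z_loc3 \<Longrightarrow> y \<in> Z_loc3 \<Longrightarrow> x + y \<in> Z_loc3"
proof (elim Z_loc3E)
  fix m d n e assume "\<not> 3 dvd d" "d \<noteq> 0" "x = of_int m / of_int d"
    "\<not> 3 dvd e" "e \<noteq> 0" "y = of_int n / of_int e"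
  then show ?thesis
    by (intro Z_loc3I[of "d * e" _ "m * e + n * d"] not_3_dvd_mult) (auto simp: field_simps)
qed

lemma Z_loc3_mult: "x \<in> Z_loc3 \<Longrightarrow> y \<in> Z_loc3 \<Longrightarrow> x * y \<in> Z_loc3"
proof (elim Z_loc3E)
  fix m d n e assume "\<not> 3 dvd d" "d \<noteq> 0" "x = of_int m / of_int d"
    "\<not> 3 dvd e" "e \<noteq> 0" "y = of_int n / of_int e"
  then show ?thesis
    by (intro Z_loc3I[of "d * e" _ "m * n"] not_3_dvd_mult) auto
qed

lemma Z_loc3_uminus: "x \<in> Z_loc3 \<Longrightarrow> - x \<in> Z_loc3"
  using Z_loc3_mult[OF Z_loc3_of_int[of "- 1"], of x] by simp

lemma Z_loc3_diff: "x \<in> Z_loc3 \<Longrightarrow> y \<in> Z_loc3 \<Longrightarrow> x - y \<in> Z_loc3"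
  using Z_loc3_add[of x "- y"] Z_loc3_uminus[of y] by simp

lemma third_notin_Z_loc3: "1 / 3 \<notin> Z_loc3"
proof
  assume "1 / 3 \<in> Z_loc3"
  then obtain m d where md: "\<not> 3 dvd d" "d \<noteq> 0" "1 / 3 = (of_int m / of_int d :: real)"
    by (rule Z_loc3E)
  then have "of_int d = (of_int (3 * m) :: real)" by (simp add: field_simps)
  then have "d = 3 * m" by (simp only: of_int_eq_iff)
  then show False using md by simp
qed

lemma Z_loc3_cube:
  assumes "x \<in> Z_loc3"
  obtains r where "r \<in> Z_loc3" "x^3 = x + 3 * r"
proof -
  obtain m d where md: "\<not> 3 dvd d" "d \<noteq> 0" "x = of_int m / of_int d"
    using assms by (rule Z_loc3E)
  have "3 dvd m \<or> 3 dvd m - d \<or> 3 dvd m + d" using md(1) by presburger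
  then have "3 dvd m * ((m - d) * (m + d))" by (auto intro: dvd_mult dvd_mult2)
  moreover have "m * ((m - d) * (m + d)) = m^3 - m * d^2"
    by (simp add: algebra_simps power2_eq_square power3_eq_cube)
  ultimately have "3 dvd m^3 - m * d^2" by simp
  then obtain k where k: "m^3 - m * d^2 = 3 * k" by (rule dvdE)
  have "x^3 - x = of_int (m^3 - m * d^2) / of_int (d * (d * d))"
    using md(2) unfolding md(3) by (simp add: field_simps power2_eq_square power3_eq_cube)
  then have "x^3 = x + 3 * (of_int k / of_int (d * (d * d)))" unfolding k by simp
  moreover have "of_int k / of_int (d * (d * d)) \<in> Z_loc3"
    by (rule Z_loc3I[OF _ refl]) (intro not_3_dvd_mult md)
  ultimately show ?thesis using that by blast
qed

lemma gauss_rats_iff: "x \<in> gauss_rats \<longleftrightarrow> Re x \<in> \<rat> \<and> Im x \<in> \<rat>"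
proof
  assume "Re x \<in> \<rat> \<and> Im x \<in> \<rat>"
  then obtain r s where "Re x = of_rat r" "Im x = of_rat s" by (auto elim!: Rats_cases)
  then have "x = of_real (of_rat r) + of_real (of_rat s) * \<i>" by (simp add: complex_eq_iff)
  then show "x \<in> gauss_rats" unfolding gauss_rats_def by blast
qed (auto simp: gauss_rats_def)

interpretation gauss_rats: subfield_of gauss_rats
  by unfold_locales
     (auto simp: gauss_rats_iff intro!: Rats_add Rats_mult Rats_diff Rats_minus_iff[THEN iffD2] Rats_divide Rats_power)

text \<open>Removes the common factors 3 from two fractions over one denominator without changing
  their values.\<close>

lemma primitive_at_3:
  fixes m n d :: int
  assumes "d \<noteq> 0"
  shows "\<exists>m' n' d'. d' \<noteq> 0 \<and> m * d' = m' * d \<and> n * d' = n' * d \<and>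
    \<not> (3 dvd m' \<and> 3 dvd n' \<and> 3 dvd d')"
  using assms
proof (induction "nat \<bar>d\<bar>" arbitrary: m n d rule: less_induct)
  case less
  show ?case
  proof (cases "3 dvd m \<and> 3 dvd n \<and> 3 dvd d")
    case False
    then show ?thesis using less.prems by blast
  next
    case True
    then obtain m0 n0 d0 where 0: "m = 3 * m0" "n = 3 * n0" "d = 3 * d0" by (meson dvdE)
    then have "nat \<bar>d0\<bar> < nat \<bar>d\<bar>" "d0 \<noteq> 0" using less.prems by auto
    then obtain m' n' d' where "d' \<noteq> 0" "m0 * d' = m' * d0" "n0 * d' = n' * d0"
      "\<not> (3 dvd m' \<and> 3 dvd n' \<and> 3 dvd d')"
      using less.hyps by blast
    then show ?thesis unfolding 0
      by (intro exI[of _ m'] exI[of _ n'] exI[of _ d']) auto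
  qed
qed

text \<open>Write x = (m + ni)/d without a common factor 3. Outside the ring 3 divides d, hence not
  both m and n, and then not m^2 + n^2, because -1 is not a square modulo 3. The inverse d(m -
  ni)/(m^2 + n^2) therefore keeps the factor 3 of d.\<close>

lemma gauss_rat_inverse_loc3:
  assumes x: "x \<in> gauss_rats" and nR: "x \<notin> Zi_loc3"
  shows "inverse x / 3 \<in> Zi_loc3"
proof -
  have "Re x \<in> \<rat>" "Im x \<in> \<rat>" using x by (simp_all add: gauss_rats_iff)
  then obtain m1 d1 m2 d2 where 1: "d1 > 0" "Re x = of_int m1 / of_int d1"
    and 2: "d2 > 0" "Im x = of_int m2 / of_int d2"
    by (elim Rats_cases')
  then have "d1 * d2 \<noteq> 0" by simp
  from primitive_at_3[OF this, of "m1 * d2" "m2 * d1"] obtain m n d where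
    d0: "d \<noteq> 0" and m: "m1 * d2 * d = m * (d1 * d2)" and n: "m2 * d1 * d = n * (d1 * d2)"
    and prim: "\<not> (3 dvd m \<and> 3 dvd n \<and> 3 dvd d)"
    by blast
  have "m1 * d = m * d1" "m2 * d = n * d2" using m n 1(1) 2(1) by auto
  then have "of_int m1 * of_int d = (of_int m * of_int d1 :: real)"
    "of_int m2 * of_int d = (of_int n * of_int d2 :: real)"
    by (metis of_int_mult)+
  then have md: "Re x = of_int m / of_int d" "Im x = of_int n / of_int d"
    using 1 2 d0 by (simp_all add: frac_eq_eq)
  have d3: "3 dvd d"
  proof (rule ccontr)
    assume d: "\<not> 3 dvd d"
    show False using nR Z_loc3I[OF d md(1)] Z_loc3I[OF d md(2)] unfolding Zi_loc3_def by simp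
  qed
  then obtain d' where d': "d = 3 * d'" by (rule dvdE)
  have mn: "\<not> (3 dvd m \<and> 3 dvd n)" using prim d3 by blast
  have N3: "\<not> 3 dvd m * m + n * n"
  proof -
    have rem: "\<exists>q e. k = 3 * q + e \<and> (e = - 1 \<or> e = 0 \<or> e = 1)" for k :: int by presburger
    obtain q e q' e' where e: "m = 3 * q + e" "e = - 1 \<or> e = 0 \<or> e = 1"
      and e': "n = 3 * q' + e'" "e' = - 1 \<or> e' = 0 \<or> e' = 1"
      using rem[of m] rem[of n] by blast
    have "m * m + n * n = 3 * (3 * (q * q) + 2 * q * e + 3 * (q' * q') + 2 * q' * e') + (e * e + e' * e')"
      unfolding e e' by (simp add: algebra_simps)
    then have "3 dvd m * m + n * n \<longleftrightarrow> 3 dvd e * e + e' * e'"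
      by (simp only: dvd_add_right_iff dvd_triv_left)
    then show ?thesis using e e' mn by auto
  qed
  define N where "N = m * m + n * n"
  have N0: "(of_int N :: real) \<noteq> 0" using N3 unfolding N_def by (metis dvd_0_right of_int_eq_0_iff)
  have d'0: "(of_int d' :: real) \<noteq> 0" using d0 d' by simp
  define z where "z = Complex (of_int (d' * m) / of_int N) (of_int (- d' * n) / of_int N)"
  have "Re (x * (3 * z)) = (of_int m * of_int m + of_int n * of_int n) / of_int N"
    using d'0 by (simp add: z_def md d' add_divide_distrib)
  also have "\<dots> = 1" using N0 by (simp add: N_def)
  finally have "Re (x * (3 * z)) = 1" .
  moreover have "Im (x * (3 * z)) = 0"
    using d'0 by (simp add: z_def md d')
  ultimately have "x * (3 * z) = 1" by (simp only: complex_eq_iff one_complex.sel)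
  then have "inverse x = 3 * z" by (rule inverse_unique)
  then have "inverse x / 3 = z" by simp
  moreover have "z \<in> Zi_loc3"
    unfolding Zi_loc3_def z_def N_def mem_Collect_eq complex.sel by (intro conjI Z_loc3I[OF N3 refl])
  ultimately show ?thesis by simp
qed

text \<open>At the inert prime 3 the Frobenius is complex conjugation; applying it twice gives x^9
  congruent to x.\<close>

lemma Zi_loc3_cube:
  assumes "x \<in> Zi_loc3"
  obtains r where "r \<in> Zi_loc3" "x^3 = cnj x + 3 * r"
proof -
  have R: "Re x \<in> Z_loc3" "Im x \<in> Z_loc3" using assms by (auto simp: Zi_loc3_def)
  obtain r s where rs: "r \<in> Z_loc3" "Re x ^ 3 = Re x + 3 * r" "s \<in> Z_loc3" "Im x ^ 3 = Im x + 3 * s"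
    using Z_loc3_cube R by metis
  let ?r = "Complex (r - Re x * (Im x * Im x)) (Re x * Re x * Im x - s)"
  have "x^3 = cnj x + 3 * ?r"
    using rs(2,4) by (simp add: complex_eq_iff power3_eq_cube algebra_simps)
  moreover have "?r \<in> Zi_loc3"
    using R rs unfolding Zi_loc3_def by (auto intro!: Z_loc3_diff Z_loc3_mult)
  ultimately show ?thesis using that by blast
qed

interpretation gauss_rats: place9_i gauss_rats Zi_loc3 \<i>
proof unfold_locales
  note loc = Z_loc3_add Z_loc3_mult Z_loc3_uminus Z_loc3_diff
  have int: "of_int m \<in> Zi_loc3" for m
    using Z_loc3_of_int[of m] Z_loc3_of_int[of 0] by (simp add: Zi_loc3_def)
  show one: "1 \<in> Zi_loc3" using int[of 1] by simp
  show "\<i> \<in> Zi_loc3"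
    using Z_loc3_of_int[of 1] Z_loc3_of_int[of 0] by (simp add: Zi_loc3_def)
  show add: "x + y \<in> Zi_loc3" if "x \<in> Zi_loc3" "y \<in> Zi_loc3" for x y
    using that loc by (simp add: Zi_loc3_def)
  show mult: "x * y \<in> Zi_loc3" if "x \<in> Zi_loc3" "y \<in> Zi_loc3" for x y
    using that loc by (simp add: Zi_loc3_def)
  show "- x \<in> Zi_loc3" if "x \<in> Zi_loc3" for x
    using that loc by (simp add: Zi_loc3_def)
  show "x \<in> gauss_rats" if "x \<in> Zi_loc3" for x
    using that by (auto simp: Zi_loc3_def Z_loc3_def gauss_rats_iff)
  show "inverse x / 3 \<in> Zi_loc3" if "x \<in> gauss_rats" "x \<notin> Zi_loc3" for x
    using gauss_rat_inverse_loc3 that .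
  show "1 / 3 \<notin> Zi_loc3"
    using third_notin_Z_loc3 by (simp add: Zi_loc3_def)
  show "\<i>^2 = - 1" by simp
  show "(x ^ 9 - x) / 3 \<in> Zi_loc3" if x: "x \<in> Zi_loc3" for x
  proof -
    obtain r where r: "r \<in> Zi_loc3" "x^3 = cnj x + 3 * r" using Zi_loc3_cube[OF x] .
    have cnj: "cnj y \<in> Zi_loc3" if "y \<in> Zi_loc3" for y
      using that loc by (simp add: Zi_loc3_def)
    have "(cnj x)^3 = x + 3 * cnj r"
      using arg_cong[OF r(2), of cnj] by simp
    moreover have "x^9 = (x^3)^3" by (simp flip: power_mult)
    ultimately have "x^9 - x = 3 * (cnj r + 3 * (cnj x * cnj x * r) + 9 * (cnj x * (r * r)) + 9 * (r * (r * r)))"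
      unfolding r(2) by algebra
    then have "(x^9 - x) / 3 = cnj r + 3 * (cnj x * cnj x * r) + 9 * (cnj x * (r * r)) + 9 * (r * (r * r))"
      by simp
    also have "\<dots> \<in> Zi_loc3"
      using int[of 3] int[of 9] by (intro add mult cnj r x) simp_all
    finally show ?thesis .
  qed
qed

text \<open>Finitely many triples have finitely many entries, so by pigeonhole \<open>fam_a\<close>
  takes one value at infinitely many parameters. Being a nonconstant rational function, it
  cannot.\<close>

lemma infinite_gauss_triples:
  "infinite {{a, b, c} | a b c :: complex. diophantine_triple gauss_rats a b c \<and>
     ec_torsion_group gauss_rats a b c \<cong> Z4xZ4}" (is "infinite ?S")
proof
  assume fin: "finite ?S"
  define t where "t = (\<lambda>n::nat. \<i> + 9 * of_nat n :: complex)"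
  have t: "t n - \<i> \<in> gauss_rats.multiples 9" for n
    by (rule gauss_rats.multiplesI[OF gauss_rats.R_of_nat[of n]]) (simp add: t_def)
  have mem: "{fam_a \<i> (t n), fam_b \<i> (t n), fam_c \<i> (t n)} \<in> ?S" for n
    using gauss_rats.family(1,2)[OF t] unfolding mem_Collect_eq
    by (intro exI[of _ "fam_a \<i> (t n)"] exI[of _ "fam_b \<i> (t n)"] exI[of _ "fam_c \<i> (t n)"]) simp
  have "range (\<lambda>n. fam_a \<i> (t n)) \<subseteq> \<Union> ?S"
  proof (rule image_subsetI)
    show "fam_a \<i> (t n) \<in> \<Union> ?S" for n by (rule UnionI[OF mem[of n]]) simp
  qed
  moreover have "finite (\<Union> ?S)"
  proof (rule finite_Union[OF fin])
    fix X assume "X \<in> ?S"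
    then obtain a b c where "X = {a, b, c}" by (auto simp only: mem_Collect_eq)
    then show "finite X" by simp
  qed
  ultimately have "finite (range (\<lambda>n. fam_a \<i> (t n)))" by (rule finite_subset)
  then obtain n0 where inf: "infinite {n \<in> UNIV. fam_a \<i> (t n) = fam_a \<i> (t n0)}"
    using pigeonhole_infinite[of "UNIV :: nat set"] by auto
  define v where "v = fam_a \<i> (t n0)"
  have v: "v \<noteq> 0" using gauss_rats.fam_nz[OF t] by (simp add: v_def)
  \<comment> \<open>The equation \<open>fam_a\<close> = v cleared of denominators, as a polynomial
    in the parameter. The numerator has degree 5 and the denominator degree 6, so the leading
    coefficient is \<open>v\<close>, which is nonzero.\<close>
  define Q where "Q = [:- 4 * \<i> - 4 * v, - 12 * \<i> - 12 * v, - 8 * \<i> - 10 * v, 4 * \<i>, 12 * \<i>, 8 * \<i> - 2 * v, v:]"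
  have "poly Q (t n) = 0" if "fam_a \<i> (t n) = v" for n
  proof -
    define x where "x = t n"
    have "(fam_u x + fam_p x) * (fam_u x ^ 2 + fam_p x ^ 2) \<noteq> 0"
      using gauss_rats.fam_units[OF t, of n] gauss_rats.unit_nz by (auto simp: x_def)
    then have "v * ((fam_u x + fam_p x) * (fam_u x ^ 2 + fam_p x ^ 2)) = - 4 * \<i> * fam_p x * fam_q x * fam_u x"
      using that unfolding fam_a_def x_def by (metis nonzero_divide_eq_eq)
    then show ?thesis
      unfolding Q_def fam_u_def fam_p_def fam_q_def x_def[symmetric] poly_pCons poly_0 by algebra
  qed
  then have "t ` {n. fam_a \<i> (t n) = v} \<subseteq> {x. poly Q x = 0}" by blast
  moreover have "finite {x. poly Q x = 0}"
    using v by (intro poly_roots_finite) (simp add: Q_def)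
  ultimately have "finite (t ` {n. fam_a \<i> (t n) = v})" by (rule finite_subset)
  then have "finite {n. fam_a \<i> (t n) = v}"
    by (rule finite_imageD) (auto simp: inj_on_def t_def)
  then show False using inf by (simp add: v_def)
qed

section \<open>The rational function field\<close>

instance fract :: ("{idom, ring_char_0}") field_char_0
proof
  show "inj (of_nat :: nat \<Rightarrow> 'a fract)"
    by (auto simp: inj_on_def of_nat_fract eq_fract)
qed

lemma gauss_rat_poly_const: "x \<in> gauss_rats \<Longrightarrow> gauss_rat_poly [:x:]"
  unfolding gauss_rat_poly_def by (auto simp: coeff_pCons gauss_rats.K_zero split: nat.split)

lemma gauss_rat_poly_X: "gauss_rat_poly [:0, 1:]"
  unfolding gauss_rat_poly_def
  by (auto simp: coeff_pCons gauss_rats.K_zero gauss_rats.K_one split: nat.split)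

lemma gauss_rat_poly_zero: "gauss_rat_poly 0"
  by (simp add: gauss_rat_poly_def gauss_rats.K_zero)

lemma gauss_rat_poly_one: "gauss_rat_poly 1"
  using gauss_rat_poly_const[OF gauss_rats.K_one] by (simp add: one_pCons)

lemma gauss_rat_poly_add: "gauss_rat_poly p \<Longrightarrow> gauss_rat_poly q \<Longrightarrow> gauss_rat_poly (p + q)"
  by (simp add: gauss_rat_poly_def gauss_rats.K_add)

lemma gauss_rat_poly_uminus: "gauss_rat_poly p \<Longrightarrow> gauss_rat_poly (- p)"
  by (simp add: gauss_rat_poly_def gauss_rats.K_uminus)

lemma gauss_rats_sum: "(\<And>i. i \<in> I \<Longrightarrow> f i \<in> gauss_rats) \<Longrightarrow> sum f I \<in> gauss_rats"
  by (induction I rule: infinite_finite_induct) (auto intro: gauss_rats.K_zero gauss_rats.K_add)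

lemma gauss_rat_poly_mult: "gauss_rat_poly p \<Longrightarrow> gauss_rat_poly q \<Longrightarrow> gauss_rat_poly (p * q)"
  unfolding gauss_rat_poly_def coeff_mult
  by (auto intro!: gauss_rats_sum gauss_rats.K_mult)

lemma gauss_rat_poly_at_0: "gauss_rat_poly p \<Longrightarrow> poly p 0 \<in> gauss_rats"
  by (simp add: gauss_rat_poly_def poly_0_coeff_0)

lemmas gauss_rat_poly_intros = gauss_rat_poly_zero gauss_rat_poly_one gauss_rat_poly_add
  gauss_rat_poly_uminus gauss_rat_poly_mult

lemma gauss_rat_funsI: "gauss_rat_poly p \<Longrightarrow> gauss_rat_poly q \<Longrightarrow> q \<noteq> 0 \<Longrightarrow> Fract p q \<in> gauss_rat_funs"
  unfolding gauss_rat_funs_def by blast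

lemma gauss_rat_funsE:
  assumes "f \<in> gauss_rat_funs"
  obtains p q where "gauss_rat_poly p" "gauss_rat_poly q" "q \<noteq> 0" "f = Fract p q"
  using assms unfolding gauss_rat_funs_def by blast

interpretation rat_funs: subfield_of gauss_rat_funs
proof
  show one: "1 \<in> gauss_rat_funs"
    unfolding One_fract_def by (intro gauss_rat_funsI gauss_rat_poly_intros) simp
  have zero: "0 \<in> gauss_rat_funs"
    unfolding Zero_fract_def by (intro gauss_rat_funsI gauss_rat_poly_intros) simp
  fix x :: "complex poly fract" assume "x \<in> gauss_rat_funs"
  then obtain p q where x: "gauss_rat_poly p" "gauss_rat_poly q" "q \<noteq> 0" "x = Fract p q"
    by (rule gauss_rat_funsE)
  show "- x \<in> gauss_rat_funs"
    unfolding x minus_fract by (intro gauss_rat_funsI gauss_rat_poly_intros x)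
  show "inverse x \<in> gauss_rat_funs"
  proof (cases "p = 0")
    case True
    then show ?thesis using zero x by (simp add: fract_collapse)
  next
    case False
    then show ?thesis unfolding x inverse_fract by (intro gauss_rat_funsI x)
  qed
  fix y :: "complex poly fract" assume "y \<in> gauss_rat_funs"
  then obtain r s where y: "gauss_rat_poly r" "gauss_rat_poly s" "s \<noteq> 0" "y = Fract r s"
    by (rule gauss_rat_funsE)
  show "x + y \<in> gauss_rat_funs"
    unfolding x y add_fract[OF x(3) y(3)]
    using x y by (intro gauss_rat_funsI gauss_rat_poly_intros) auto
  show "x * y \<in> gauss_rat_funs"
    unfolding x y mult_fract
    using x y by (intro gauss_rat_funsI gauss_rat_poly_intros) auto
qed

text \<open>A relation, since a function with a pole at 0 has no value; that the value does not
  depend on the fraction is \<open>value_at_0_unique\<close>.\<close>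

definition value_at_0 :: "complex poly fract \<Rightarrow> complex \<Rightarrow> bool" where
  "value_at_0 f v \<longleftrightarrow> (\<exists>p q. gauss_rat_poly p \<and> gauss_rat_poly q \<and> poly q 0 \<noteq> 0 \<and>
     f = Fract p q \<and> v = poly p 0 / poly q 0)"

lemma value_at_0I:
  "gauss_rat_poly p \<Longrightarrow> gauss_rat_poly q \<Longrightarrow> poly q 0 \<noteq> 0 \<Longrightarrow> value_at_0 (Fract p q) (poly p 0 / poly q 0)"
  unfolding value_at_0_def by blast

lemma value_at_0E:
  assumes "value_at_0 f v"
  obtains p q where "gauss_rat_poly p" "gauss_rat_poly q" "poly q 0 \<noteq> 0" "q \<noteq> 0" "f = Fract p q"
    "v = poly p 0 / poly q 0"
  using assms unfolding value_at_0_def by force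

lemma value_at_0_unique: "value_at_0 f v \<Longrightarrow> value_at_0 f w \<Longrightarrow> v = w"
proof (elim value_at_0E)
  fix p q r s :: "complex poly"
  assume f: "f = Fract p q" "f = Fract r s" and nz: "q \<noteq> 0" "s \<noteq> 0" "poly q 0 \<noteq> 0" "poly s 0 \<noteq> 0"
    and v: "v = poly p 0 / poly q 0" "w = poly r 0 / poly s 0"
  have "p * s = r * q" using f nz by (simp add: eq_fract)
  then have "poly p 0 * poly s 0 = poly r 0 * poly q 0" by (metis poly_mult)
  then show "v = w" using v nz by (simp add: frac_eq_eq)
qed

lemma value_at_0_const: "x \<in> gauss_rats \<Longrightarrow> value_at_0 (Fract [:x:] 1) x"
  using value_at_0I[OF gauss_rat_poly_const gauss_rat_poly_one, of x] by simp

lemma value_at_0_one: "value_at_0 1 1"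
  using value_at_0I[OF gauss_rat_poly_one gauss_rat_poly_one] by (simp add: One_fract_def)

lemma value_at_0_add: "value_at_0 f v \<Longrightarrow> value_at_0 g w \<Longrightarrow> value_at_0 (f + g) (v + w)"
proof (elim value_at_0E)
  fix p q r s :: "complex poly"
  assume *: "gauss_rat_poly p" "gauss_rat_poly q" "gauss_rat_poly r" "gauss_rat_poly s"
    "f = Fract p q" "g = Fract r s" "q \<noteq> 0" "s \<noteq> 0" "poly q 0 \<noteq> 0" "poly s 0 \<noteq> 0"
    "v = poly p 0 / poly q 0" "w = poly r 0 / poly s 0"
  have "value_at_0 (Fract (p * s + r * q) (q * s)) (poly (p * s + r * q) 0 / poly (q * s) 0)"
    using * by (intro value_at_0I gauss_rat_poly_intros) auto
  moreover have "poly (p * s + r * q) 0 / poly (q * s) 0 = v + w"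
    using * by (simp add: add_frac_eq)
  ultimately show ?thesis using * by simp
qed

lemma value_at_0_mult: "value_at_0 f v \<Longrightarrow> value_at_0 g w \<Longrightarrow> value_at_0 (f * g) (v * w)"
proof (elim value_at_0E)
  fix p q r s :: "complex poly"
  assume *: "gauss_rat_poly p" "gauss_rat_poly q" "gauss_rat_poly r" "gauss_rat_poly s"
    "f = Fract p q" "g = Fract r s" "q \<noteq> 0" "s \<noteq> 0" "poly q 0 \<noteq> 0" "poly s 0 \<noteq> 0"
    "v = poly p 0 / poly q 0" "w = poly r 0 / poly s 0"
  have "value_at_0 (Fract (p * r) (q * s)) (poly (p * r) 0 / poly (q * s) 0)"
    using * by (intro value_at_0I gauss_rat_poly_intros) auto
  then show ?thesis using * by simp
qed

lemma value_at_0_uminus: "value_at_0 f v \<Longrightarrow> value_at_0 (- f) (- v)"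
proof (elim value_at_0E)
  fix p q :: "complex poly"
  assume *: "gauss_rat_poly p" "gauss_rat_poly q" "f = Fract p q" "q \<noteq> 0" "poly q 0 \<noteq> 0"
    "v = poly p 0 / poly q 0"
  have "value_at_0 (Fract (- p) q) (poly (- p) 0 / poly q 0)"
    using * by (intro value_at_0I gauss_rat_poly_intros) auto
  then show ?thesis using * by simp
qed

lemma value_at_0_inverse: "value_at_0 f v \<Longrightarrow> v \<noteq> 0 \<Longrightarrow> value_at_0 (inverse f) (inverse v)"
proof (elim value_at_0E)
  fix p q :: "complex poly"
  assume *: "gauss_rat_poly p" "gauss_rat_poly q" "f = Fract p q" "q \<noteq> 0" "poly q 0 \<noteq> 0"
    "v = poly p 0 / poly q 0" "v \<noteq> 0"
  have "value_at_0 (Fract q p) (poly q 0 / poly p 0)"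
    using * by (intro value_at_0I) auto
  then show ?thesis using * by simp
qed

lemma value_at_0_diff: "value_at_0 f v \<Longrightarrow> value_at_0 g w \<Longrightarrow> value_at_0 (f - g) (v - w)"
  using value_at_0_add[of f v "- g" "- w"] value_at_0_uminus by simp

lemma value_at_0_power: "value_at_0 f v \<Longrightarrow> value_at_0 (f ^ n) (v ^ n)"
  by (induction n) (auto intro: value_at_0_one value_at_0_mult)

lemma value_at_0_of_nat: "value_at_0 (of_nat n) (of_nat n)"
proof (induction n)
  case 0
  then show ?case using value_at_0_const[OF gauss_rats.K_zero] by (simp add: fract_collapse)
next
  case (Suc n)
  then show ?case using value_at_0_add[OF value_at_0_one] by simp
qed

lemma value_at_0_divide_numeral: "value_at_0 f v \<Longrightarrow> value_at_0 (f / numeral n) (v / numeral n)"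
  unfolding divide_inverse
  using value_at_0_of_nat[of "numeral n"] by (intro value_at_0_mult value_at_0_inverse) simp_all

text \<open>Every rational function or its reciprocal is defined at 0, by cancelling powers of the
  variable.\<close>
lemma gauss_rat_funs_cases:
  assumes "f \<in> gauss_rat_funs"
  obtains v where "value_at_0 f v" | "value_at_0 (inverse f) 0"
proof -
  obtain p q where "gauss_rat_poly p" "gauss_rat_poly q" "q \<noteq> 0" "f = Fract p q"
    using assms by (rule gauss_rat_funsE)
  then have "(\<exists>v. value_at_0 f v) \<or> value_at_0 (inverse f) 0"
  proof (induction "degree q" arbitrary: p q rule: less_induct)
    case less
    consider "poly q 0 \<noteq> 0" | "poly q 0 = 0" "poly p 0 \<noteq> 0" | "poly q 0 = 0" "poly p 0 = 0" by blast
    then show ?case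
    proof cases
      case 1
      then show ?thesis using value_at_0I less.prems by blast
    next
      case 2
      then have "value_at_0 (Fract q p) (poly q 0 / poly p 0)" using value_at_0I less.prems by blast
      then show ?thesis using less.prems 2 by simp
    next
      case 3
      obtain a p' where p: "p = pCons a p'" by (rule pCons_cases)
      obtain b q' where q: "q = pCons b q'" by (rule pCons_cases)
      have ab: "a = 0" "b = 0" using 3 p q by auto
      have q': "q' \<noteq> 0" using less.prems(3) q ab by auto
      have "gauss_rat_poly p'" "gauss_rat_poly q'"
        using less.prems(1,2) unfolding p q gauss_rat_poly_def by (metis coeff_pCons_Suc)+
      moreover have "degree q' < degree q" using q q' by simp
      moreover have "f = Fract p' q'"
        using less.prems(3,4) q' unfolding p q ab by (simp add: eq_fract)
      ultimately show ?thesis using less.hyps q' by blast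
    qed
  qed
  then show ?thesis using that by blast
qed

text \<open>The composite of two places: evaluation at 0, then reduction at 3. Division by 3 acts on
  values, so the axioms of \<open>place9\<close> are inherited from Q(i).\<close>

definition rat_funs_loc :: "complex poly fract set" where
  "rat_funs_loc = {f. \<exists>v\<in>Zi_loc3. value_at_0 f v}"

lemma rat_funs_locI: "value_at_0 f v \<Longrightarrow> v \<in> Zi_loc3 \<Longrightarrow> f \<in> rat_funs_loc"
  unfolding rat_funs_loc_def by blast

lemma rat_funs_locE:
  assumes "f \<in> rat_funs_loc"
  obtains v where "value_at_0 f v" "v \<in> Zi_loc3"
  using assms unfolding rat_funs_loc_def by blast

interpretation rat_funs: place9_i gauss_rat_funs rat_funs_loc "Fract [:\<i>:] 1"
proof
  show "x \<in> gauss_rat_funs" if "x \<in> rat_funs_loc" for x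
    using that by (elim rat_funs_locE value_at_0E) (auto intro: gauss_rat_funsI)
  show "1 \<in> rat_funs_loc" by (rule rat_funs_locI[OF value_at_0_one gauss_rats.R_one])
  show "x + y \<in> rat_funs_loc" "x * y \<in> rat_funs_loc" if "x \<in> rat_funs_loc" "y \<in> rat_funs_loc" for x y
    using that value_at_0_add value_at_0_mult gauss_rats.R_add gauss_rats.R_mult
    by (meson rat_funs_locI rat_funs_locE)+
  show "- x \<in> rat_funs_loc" if "x \<in> rat_funs_loc" for x
    using that value_at_0_uminus gauss_rats.R_uminus by (meson rat_funs_locI rat_funs_locE)
  show "(x ^ 9 - x) / 3 \<in> rat_funs_loc" if x: "x \<in> rat_funs_loc" for x
  proof -
    obtain v where v: "value_at_0 x v" "v \<in> Zi_loc3" using x by (rule rat_funs_locE)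
    show ?thesis
      by (rule rat_funs_locI[OF _ gauss_rats.R_frobenius[OF v(2)]])
         (intro value_at_0_divide_numeral value_at_0_diff value_at_0_power v)
  qed
  show "1 / 3 \<notin> rat_funs_loc"
  proof
    assume "1 / 3 \<in> rat_funs_loc"
    then obtain v where v: "value_at_0 (1 / 3) v" "v \<in> Zi_loc3" by (rule rat_funs_locE)
    then have "v = 1 / 3"
      using value_at_0_unique value_at_0_divide_numeral[OF value_at_0_one] by blast
    then show False using v(2) gauss_rats.third_notin_R by metis
  qed
  show "inverse x / 3 \<in> rat_funs_loc" if x: "x \<in> gauss_rat_funs" and nR: "x \<notin> rat_funs_loc" for x
    using x
  proof (cases rule: gauss_rat_funs_cases)
    case (1 v)
    then have v: "v \<notin> Zi_loc3" using nR rat_funs_locI by blast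
    have "v \<in> gauss_rats"
      using 1 by (elim value_at_0E) (simp add: gauss_rats.K_divide gauss_rat_poly_at_0)
    then have "inverse v / 3 \<in> Zi_loc3" using v by (rule gauss_rats.R_inverse)
    moreover have "v \<noteq> 0" using v gauss_rats.R_zero by auto
    ultimately show ?thesis
      using rat_funs_locI[OF value_at_0_divide_numeral[OF value_at_0_inverse[OF 1]]] by blast
  next
    \<comment> \<open>At a pole of \<open>x\<close> the inverse has value 0, and so does a third of
      it.\<close>
    case 2
    then show ?thesis
      using rat_funs_locI[OF value_at_0_divide_numeral[OF 2]] gauss_rats.R_zero by simp
  qed
  show "Fract [:\<i>:] 1 \<in> rat_funs_loc"
    by (rule rat_funs_locI[OF value_at_0_const gauss_rats.j_R]) (rule gauss_rats.R_sub[OF gauss_rats.j_R])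
  show "(Fract [:\<i>:] 1)^2 = (- 1 :: complex poly fract)"
    by (simp add: power2_eq_square One_fract_def) (simp add: one_pCons)
qed

theorem theorem3:
  shows "infinite {{a, b, c} | a b c :: complex.
            diophantine_triple gauss_rats a b c \<and>
            ec_torsion_group gauss_rats a b c \<cong> Z4xZ4}
         \<and> (\<exists>a b c :: complex poly fract.
            diophantine_triple gauss_rat_funs a b c \<and>
            ec_torsion_group gauss_rat_funs a b c \<cong> Z4xZ4 \<and>
            ec_positive_rank gauss_rat_funs a b c)"
proof (rule conjI[OF infinite_gauss_triples])
  define X :: "complex poly fract" where "X = Fract [:0, 1:] 1"
  have "value_at_0 X 0"
    using value_at_0I[OF gauss_rat_poly_X gauss_rat_poly_one] by (simp add: X_def)
  \<comment> \<open>A function vanishing at 0 is divisible by 9 in this ring, so the variable itself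
    is an admissible perturbation of i.\<close>
  then have "X / 9 \<in> rat_funs_loc"
    using rat_funs_locI[OF value_at_0_divide_numeral] gauss_rats.R_zero by fastforce
  then have "(Fract [:\<i>:] 1 + X) - Fract [:\<i>:] 1 \<in> rat_funs.multiples 9"
    by (rule rat_funs.multiplesI) simp
  from rat_funs.family[OF this]
  show "\<exists>a b c :: complex poly fract.
            diophantine_triple gauss_rat_funs a b c \<and>
            ec_torsion_group gauss_rat_funs a b c \<cong> Z4xZ4 \<and>
            ec_positive_rank gauss_rat_funs a b c"
    by blast
qed

end
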